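(* Let $A=\begin{pmatrix} a & b\\ c & d\end{pmatrix}\in\mathbb{C}^{2\times2}$ be a non-singular matrix. (a) If $A$ is an upper triangular matrix (that is, $c=0$), then $$\overline{\mathrm{Num}(AD)}=\{rz: r\in[0,\infty),\ z\in\overline{\mathrm{Num}(A)}\}.$$ (b) If $A$ is not an upper triangular matrix (that is, $c\neq0$), then $\mathrm{Num}(AD)=\mathbb{C}$.
   Context: Let $W^{2,2}$ be the Sobolev space of all $f\in L^2(0,1)\otimes\mathbb{C}^2$ whose generalized derivative $f''$ lies in $L^2(0,1)\otimes\mathbb{C}^2$, and write $f=\begin{pmatrix}\phi\\ \gamma\end{pmatrix}$. The operator $D$ acts on $L^2(0,1)\otimes\mathbb{C}^2$ by $Df=-f''$ with domain $\mathrm{Dom}(D)=\{f\in W^{2,2}:\phi(0)=\phi(1)=0,\ \gamma'(0)=\gamma'(1)=0\}$. $AD$ is the operator $f\mapsto -Af''$ with domain $\mathrm{Dom}(D)$. The numerical range of a linear operator $K$ is $\mathrm{Num}(K)=\{\langle Kf,f\rangle: f\in\mathrm{Dom}(K),\ \|f\|=1\}$; for the matrix $A$ it is taken on $\mathbb{C}^2$.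
   Formalization: In (a) the right-hand side is replaced by its closure: as printed, (a) fails for A with rows (1,2),(0,1), where Num(A) is the closed disc |z−1|≤1 and the set {rz} is the open right half-plane together with 0, which is not closed. *)

theory Defs
  imports "HOL-Analysis.Analysis"
begin

text \<open>
  \<open>Num K = {\<langle>K f, f\<rangle> | f \<in> Dom K, \<parallel>f\<parallel> = 1}\<close>, where the inner product \<open>ip\<close> is linear in its first
  argument and \<open>\<parallel>f\<parallel> = sqrt \<langle>f, f\<rangle>\<close>.
\<close>

definition numerical_range ::
    "('v \<Rightarrow> 'v \<Rightarrow> complex) \<Rightarrow> 'v set \<Rightarrow> ('v \<Rightarrow> 'v) \<Rightarrow> complex set" where
  "numerical_range ip Dom K = {ip (K f) f | f. f \<in> Dom \<and> sqrt (Re (ip f f)) = 1}"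

text \<open>The library's \<open>inner\<close> on \<^typ>\<open>complex ^ 2\<close> is the real part of \<open>cinner2\<close>.\<close>

definition cinner2 :: "complex ^ 2 \<Rightarrow> complex ^ 2 \<Rightarrow> complex" where
  "cinner2 u v = (\<Sum>i\<in>UNIV. u $ i * cnj (v $ i))"

definition Num_matrix :: "complex ^ 2 ^ 2 \<Rightarrow> complex set" where
  "Num_matrix A = numerical_range cinner2 UNIV (\<lambda>v. A *v v)"

text \<open>
  Elements of \<open>L\<^sup>2(0,1) \<otimes> \<complex>\<^sup>2\<close> are represented by functions rather than by classes modulo null sets;
  values outside \<open>(0,1)\<close> are irrelevant. All notions below are invariant under changing a function
  on a null set, so the numerical range is not affected.
\<close>

abbreviation I01 :: "real measure" where
  "I01 \<equiv> lebesgue_on {0<..<1}"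

definition L2 :: "(real \<Rightarrow> complex ^ 2) set" where
  "L2 = {f. f \<in> borel_measurable I01 \<and> integrable I01 (\<lambda>x. (norm (f x))\<^sup>2)}"

definition L2_inner :: "(real \<Rightarrow> complex ^ 2) \<Rightarrow> (real \<Rightarrow> complex ^ 2) \<Rightarrow> complex" where
  "L2_inner f g = (LINT x|I01. cinner2 (f x) (g x))"

definition test_function :: "(real \<Rightarrow> real) \<Rightarrow> bool" where
  "test_function \<psi> \<longleftrightarrow>
     (\<forall>k. (deriv ^^ k) \<psi> differentiable_on UNIV) \<and> closure {x. \<psi> x \<noteq> 0} \<subseteq> {0<..<1}"

text \<open>
  \<open>g\<close> is a generalized (distributional) second derivative of \<open>f\<close> on \<open>(0,1)\<close>. Real test functions
  suffice, by linearity. Only used for \<open>f\<close> and \<open>g\<close> in \<open>L2\<close>, where both integrands are integrable.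
\<close>

definition gen_deriv2 :: "(real \<Rightarrow> complex ^ 2) \<Rightarrow> (real \<Rightarrow> complex ^ 2) \<Rightarrow> bool" where
  "gen_deriv2 f g \<longleftrightarrow>
     (\<forall>\<psi>. test_function \<psi> \<longrightarrow>
        (LINT x|I01. (deriv ^^ 2) \<psi> x *\<^sub>R f x) = (LINT x|I01. \<psi> x *\<^sub>R g x))"

definition W22 :: "(real \<Rightarrow> complex ^ 2) set" where
  "W22 = {f \<in> L2. \<exists>g\<in>L2. gen_deriv2 f g}"

text \<open>Determined only up to null sets.\<close>

definition second_deriv :: "(real \<Rightarrow> complex ^ 2) \<Rightarrow> (real \<Rightarrow> complex ^ 2)" where
  "second_deriv f = (SOME g. g \<in> L2 \<and> gen_deriv2 f g)"

text \<open>
  Every element of \<open>W22\<close> has a unique \<open>C\<^sup>1\<close> representative \<open>F\<close> on \<open>[0,1]\<close>; boundary values of a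
  function and of its derivative are those of \<open>F\<close> and its (at the end points one-sided)
  derivative \<open>F'\<close>.
\<close>

definition C1_rep ::
    "(real \<Rightarrow> complex ^ 2) \<Rightarrow> (real \<Rightarrow> complex ^ 2) \<Rightarrow> (real \<Rightarrow> complex ^ 2) \<Rightarrow> bool" where
  "C1_rep f F F' \<longleftrightarrow>
     (AE x in I01. F x = f x) \<and>
     (\<forall>x\<in>{0..1}. (F has_vector_derivative F' x) (at x within {0..1})) \<and>
     continuous_on {0..1} F'"

definition Dom_D :: "(real \<Rightarrow> complex ^ 2) set" where
  "Dom_D = {f \<in> W22. \<exists>F F'. C1_rep f F F' \<and>
     F 0 $ 1 = 0 \<and> F 1 $ 1 = 0 \<and> F' 0 $ 2 = 0 \<and> F' 1 $ 2 = 0}"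

definition op_D :: "(real \<Rightarrow> complex ^ 2) \<Rightarrow> (real \<Rightarrow> complex ^ 2)" where
  "op_D f = (\<lambda>x. - second_deriv f x)"

definition op_AD :: "complex ^ 2 ^ 2 \<Rightarrow> (real \<Rightarrow> complex ^ 2) \<Rightarrow> (real \<Rightarrow> complex ^ 2)" where
  "op_AD A f = (\<lambda>x. A *v op_D f x)"

definition Num_AD :: "complex ^ 2 ^ 2 \<Rightarrow> complex set" where
  "Num_AD A = numerical_range L2_inner Dom_D (op_AD A)"

text \<open>
  The union of the rays through \<open>S\<close>. It need not be closed, even for compact \<open>S\<close>: for the matrix
  with rows \<open>(1, 2)\<close> and \<open>(0, 1)\<close> the numerical range is the closed disc of radius \<open>1\<close> about \<open>1\<close>,
  and the rays through it fill the open right half-plane together with \<open>0\<close>.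
\<close>

definition rays :: "complex set \<Rightarrow> complex set" where
  "rays S = {complex_of_real r * z | r z. r \<in> {0..} \<and> z \<in> S}"

end

theory Submission
  imports Defs "HOL-Computational_Algebra.Polynomial" "HOL-Real_Asymp.Real_Asymp"
begin

text \<open>
  Integration by parts turns \<open>\<langle>AD f, f\<rangle>\<close> into
  \<open>\<integral> \<langle>A f', f'\<rangle> - c [\<phi>' cnj \<gamma>]\<close>, the last term being the difference of the boundary values at
  \<open>1\<close> and \<open>0\<close>.

  If \<open>c = 0\<close>, this is the value of \<open>A\<close> on the Gram matrix of \<open>(\<phi>', \<gamma>')\<close>, a positive semidefinite
  matrix, which can be replaced by one of rank one without changing the value; so \<open>Num(AD)\<close> lies in
  the rays through \<open>Num(A)\<close>. Conversely \<open>\<phi> = x (1 - cos \<omega>t)\<close>, \<open>\<gamma> = k - y cos \<omega>t\<close> has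
  \<open>f' = (x, y) \<omega> sin \<omega>t\<close>, and its norm is adjusted through the free constant \<open>k\<close>; so the two sets
  are even equal before taking closures.

  If \<open>c \<noteq> 0\<close>, take \<open>\<gamma> = 1\<close> and \<open>\<phi> = \<delta> t\<^sup>n (t - 1)\<close>. For large \<open>n\<close> the norms of \<open>\<phi>\<close> and \<open>\<phi>'\<close> are
  negligible against the boundary term \<open>- c \<delta>\<close>, and Brouwer's theorem provides a \<open>\<delta>\<close> that yields any
  prescribed value.
\<close>

section \<open>Smooth bump functions\<close>

definition poly_bump :: "real poly \<Rightarrow> real poly \<Rightarrow> nat \<Rightarrow> real \<Rightarrow> real" where
  "poly_bump q p m x =
     (if poly q x > 0 then poly p x * exp (- (1 / poly q x)) / poly q x ^ m else 0)"

text \<open>The polynomial \<open>r\<close> for which \<open>r exp (-1/q) / q\<^sup>m\<^sup>+\<^sup>2\<close> is the derivative of \<open>p exp (-1/q) / q\<^sup>m\<close>.\<close>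

definition poly_bump_next :: "real poly \<Rightarrow> real poly \<Rightarrow> nat \<Rightarrow> real poly" where
  "poly_bump_next q p m = pderiv p * q\<^sup>2 - of_nat m * p * pderiv q * q + p * pderiv q"

lemma exp_minus_inverse_bound:
  fixes t :: real
  assumes "t > 0"
  shows "exp (- (1 / t)) / t ^ m \<le> fact (m + 2) * t\<^sup>2"
proof -
  define s where "s = 1 / t"
  have s: "s > 0" using assms by (simp add: s_def)
  have "(\<Sum>k\<in>{m+2}. inverse (fact k) *\<^sub>R s ^ k) \<le> exp s"
    unfolding exp_def by (rule sum_le_suminf[OF summable_exp_generic]) (use s in auto)
  then have "s ^ (m + 2) \<le> fact (m + 2) * exp s"
    by (simp add: field_simps del: fact_Suc power_Suc)
  then have "exp (- s) * s ^ (m + 2) \<le> fact (m + 2)"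
    by (simp add: exp_minus field_simps del: fact_Suc power_Suc)
  then have "exp (- s) * s ^ (m + 2) * t\<^sup>2 \<le> fact (m + 2) * t\<^sup>2"
    by (intro mult_right_mono) auto
  moreover have "exp (- s) * s ^ (m + 2) * t\<^sup>2 = exp (- (1 / t)) / t ^ m"
    using assms by (simp add: s_def field_simps power2_eq_square)
  ultimately show ?thesis by simp
qed

lemma quotient_rule_power:
  fixes q :: real
  assumes "q > 0"
  shows "((p' * e + p * (e * (r / q\<^sup>2))) * q ^ m - p * e * (of_nat m * (r * q ^ (m - Suc 0)))) / (q ^ m * q ^ m)
    = (p' * q\<^sup>2 - of_nat m * p * r * q + p * r) * e / q ^ (m + 2)"
proof (cases m)
  case 0
  then show ?thesis using assms by (simp add: field_simps power2_eq_square)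
next
  case (Suc n)
  define Q and M where "Q = q ^ n" and "M = real m"
  have "Q > 0" using assms by (simp add: Q_def)
  have "((p' * e + p * (e * (r / q\<^sup>2))) * (q * Q) - p * e * (M * (r * Q))) / (q * Q * (q * Q))
    = (p' * q\<^sup>2 - M * p * r * q + p * r) * e / (q * Q * q\<^sup>2)"
    using assms \<open>Q > 0\<close> by (simp add: divide_simps power2_eq_square) (simp add: algebra_simps)
  moreover have "q ^ m = q * Q" "q ^ (m - Suc 0) = Q" "q ^ (m + 2) = q * Q * q\<^sup>2"
    by (simp_all add: Suc Q_def power_add power2_eq_square)
  ultimately show ?thesis by (simp only: M_def)
qed

lemma poly_bump_has_derivative:
  "(poly_bump q p m has_real_derivative poly_bump q (poly_bump_next q p m) (m + 2) x) (at x)"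
proof (cases "poly q x" "0 :: real" rule: linorder_cases)
  case greater
  have ev: "\<forall>\<^sub>F y in nhds x. poly q y > 0"
    using eventually_nhds_in_open[of "{y. 0 < poly q y}" x] greater
    by (simp add: open_Collect_less continuous_intros)
  define e where "e = exp (- (1 / poly q x))"
  let ?q' = "poly (pderiv q) x" and ?p' = "poly (pderiv p) x" and ?q = "poly q x"
  have "((\<lambda>y. poly p y * exp (- (1 / poly q y))) has_real_derivative
      ?p' * e + poly p x * (e * (?q' / ?q\<^sup>2))) (at x)"
    unfolding e_def using greater
    by (auto intro!: derivative_eq_intros simp: power2_eq_square)
  from DERIV_divide[OF this DERIV_power[OF poly_DERIV[of q x], of m]]
  have "((\<lambda>y. poly p y * exp (- (1 / poly q y)) / poly q y ^ m) has_real_derivative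
      ((?p' * e + poly p x * (e * (?q' / ?q\<^sup>2))) * ?q ^ m
        - poly p x * e * (of_nat m * (?q' * ?q ^ (m - Suc 0)))) / (?q ^ m * ?q ^ m)) (at x)"
    using greater by (simp add: e_def)
  also have "((?p' * e + poly p x * (e * (?q' / ?q\<^sup>2))) * ?q ^ m
        - poly p x * e * (of_nat m * (?q' * ?q ^ (m - Suc 0)))) / (?q ^ m * ?q ^ m)
      = poly_bump q (poly_bump_next q p m) (m + 2) x"
    using quotient_rule_power[of ?q ?p' e "poly p x" ?q' m] greater
    by (simp add: poly_bump_def poly_bump_next_def e_def mult.commute)
  finally have "((\<lambda>y. poly p y * exp (- (1 / poly q y)) / poly q y ^ m) has_real_derivative
      poly_bump q (poly_bump_next q p m) (m + 2) x) (at x)" .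
  moreover have "\<forall>\<^sub>F y in nhds x. poly_bump q p m y = poly p y * exp (- (1 / poly q y)) / poly q y ^ m"
    using ev by eventually_elim (simp add: poly_bump_def)
  ultimately show ?thesis
    by (simp only: DERIV_cong_ev[OF refl _ refl])
next
  case less
  have ev: "\<forall>\<^sub>F y in nhds x. poly q y < 0"
    using eventually_nhds_in_open[of "{y. poly q y < 0}" x] less
    by (simp add: open_Collect_less continuous_intros)
  then have "\<forall>\<^sub>F y in nhds x. poly_bump q p m y = 0"
    by eventually_elim (simp add: poly_bump_def)
  moreover have "((\<lambda>y. 0) has_real_derivative poly_bump q (poly_bump_next q p m) (m + 2) x) (at x)"
    using less by (simp add: poly_bump_def)
  ultimately show ?thesis
    by (simp only: DERIV_cong_ev[OF refl _ refl])
next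
  case equal
  define C where "C y = \<bar>poly p y\<bar> * fact (m + 2) * (poly q y)\<^sup>2" for y
  have bound: "\<bar>poly_bump q p m y\<bar> \<le> C y" for y
  proof (cases "poly q y > 0")
    case True
    have "\<bar>poly p y\<bar> * (exp (- (1 / poly q y)) / poly q y ^ m)
        \<le> \<bar>poly p y\<bar> * (fact (m + 2) * (poly q y)\<^sup>2)"
      by (intro mult_left_mono exp_minus_inverse_bound True) auto
    then show ?thesis using True
      by (simp add: poly_bump_def C_def abs_mult mult_ac)
  qed (auto simp: poly_bump_def C_def)
  have quot: "((\<lambda>y. (poly q y - poly q x) / (y - x)) \<longlongrightarrow> poly (pderiv q) x) (at x)"
    using poly_DERIV[of q x] by (simp add: has_field_derivative_iff)
  have "((\<lambda>y. \<bar>poly p y\<bar> * fact (m + 2) * \<bar>poly q y\<bar> * \<bar>(poly q y - poly q x) / (y - x)\<bar>) \<longlongrightarrow>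
      \<bar>poly p x\<bar> * fact (m + 2) * \<bar>poly q x\<bar> * \<bar>poly (pderiv q) x\<bar>) (at x)"
    by (intro tendsto_intros quot)
  then have lim: "((\<lambda>y. C y / \<bar>y - x\<bar>) \<longlongrightarrow> 0) (at x)"
    using equal by (simp add: C_def power2_eq_square abs_mult field_simps)
  have "((\<lambda>y. (poly_bump q p m y - poly_bump q p m x) / (y - x)) \<longlongrightarrow> 0) (at x)"
  proof (rule Lim_null_comparison[OF _ lim])
    show "\<forall>\<^sub>F y in at x. norm ((poly_bump q p m y - poly_bump q p m x) / (y - x)) \<le> C y / \<bar>y - x\<bar>"
      using bound equal by (intro always_eventually) (auto simp: poly_bump_def divide_right_mono)
  qed
  then show ?thesis
    using equal by (simp add: has_field_derivative_iff poly_bump_def)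
qed

fun bump_deriv_poly :: "real poly \<Rightarrow> nat \<Rightarrow> real poly" where
  "bump_deriv_poly q 0 = 1"
| "bump_deriv_poly q (Suc k) = poly_bump_next q (bump_deriv_poly q k) (2 * k)"

lemma bump_seq:
  fixes a b :: real
  assumes "a < b"
  obtains D :: "nat \<Rightarrow> real \<Rightarrow> real"
  where "\<And>k x. (D k has_real_derivative D (Suc k) x) (at x)"
    "\<And>x. x \<in> {a<..<b} \<Longrightarrow> D 0 x > 0" "\<And>x. x \<notin> {a<..<b} \<Longrightarrow> D 0 x = 0"
proof -
  define q where "q = [:- a, 1:] * [:b, -1:]"
  have q: "poly q x = (x - a) * (b - x)" for x
    by (simp add: q_def algebra_simps)
  have pos: "poly q x > 0 \<longleftrightarrow> x \<in> {a<..<b}" for x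
    using assms by (auto simp: q zero_less_mult_iff)
  show ?thesis
  proof (rule that[of "\<lambda>k. poly_bump q (bump_deriv_poly q k) (2 * k)"])
    show "(poly_bump q (bump_deriv_poly q k) (2 * k) has_real_derivative
        poly_bump q (bump_deriv_poly q (Suc k)) (2 * Suc k) x) (at x)" for k x
      using poly_bump_has_derivative[of q "bump_deriv_poly q k" "2 * k" x] by simp
  qed (simp_all add: poly_bump_def pos)
qed

lemma deriv_funpow_seq:
  assumes "\<And>k x. (D k has_real_derivative D (Suc k) x) (at x)"
  shows "(deriv ^^ k) (D 0) = D k"
  by (induction k) (auto intro!: ext DERIV_imp_deriv assms)

lemma test_function_seqI:
  assumes D: "\<And>k x. (D k has_real_derivative D (Suc k) x) (at x)"
    and "0 < a" "b < 1" "\<And>x. x \<notin> {a..b} \<Longrightarrow> D 0 x = 0"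
  shows "test_function (D 0)"
  unfolding test_function_def
proof safe
  show "(deriv ^^ k) (D 0) differentiable_on UNIV" for k
    using D by (auto simp: deriv_funpow_seq[of D, OF D] differentiable_on_def has_field_derivative_def differentiable_def)
  fix x assume "x \<in> closure {x. D 0 x \<noteq> 0}"
  moreover have "closure {x. D 0 x \<noteq> 0} \<subseteq> {a..b}"
    by (rule closure_minimal) (use assms(4) in blast)+
  ultimately show "x \<in> {0<..<1}" using assms by auto
qed

section \<open>Integration by parts\<close>

text \<open>
  \<open>G\<close> is only absolutely continuous. The defect \<open>P\<close> of the product rule satisfies
  \<open>\<bar>P y - P x\<bar> \<le> C (y - x) \<integral>\<^sub>x\<^sup>y \<bar>g\<bar>\<close>, so its derivative vanishes everywhere.
\<close>

lemma has_integral_indefinite_parts: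
  fixes u u' :: "real \<Rightarrow> 'a::euclidean_space" and g G :: "real \<Rightarrow> 'b::euclidean_space"
    and h :: "'a \<Rightarrow> 'b \<Rightarrow> 'c::euclidean_space"
  assumes h: "bounded_bilinear h" and ab: "a \<le> b"
    and u: "\<And>x. x \<in> {a..b} \<Longrightarrow> (u has_vector_derivative u' x) (at x within {a..b})"
    and cu': "continuous_on {a..b} u'"
    and g: "g absolutely_integrable_on {a..b}"
    and G: "\<And>x. x \<in> {a..b} \<Longrightarrow> G x = G a + integral {a..x} g"
  shows "(\<lambda>x. h (u x) (g x)) absolutely_integrable_on {a..b}"
    and "((\<lambda>x. h (u x) (g x) + h (u' x) (G x)) has_integral h (u b) (G b) - h (u a) (G a)) {a..b}"
proof -
  interpret h: bounded_bilinear h by (rule h)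
  obtain K where K: "K \<ge> 0" "\<And>x y. norm (h x y) \<le> norm x * norm y * K"
    using h.nonneg_bounded by blast
  have "compact (u' ` {a..b})"
    by (intro compact_continuous_image cu') auto
  then obtain L where "L > 0" and L: "\<And>x. x \<in> {a..b} \<Longrightarrow> norm (u' x) \<le> L"
    by (auto dest!: compact_imp_bounded simp: bounded_pos)
  have cu: "continuous_on {a..b} u"
    by (rule continuous_on_vector_derivative[OF u])
  have gi: "g integrable_on {a..b}" and ngi: "(\<lambda>x. norm (g x)) integrable_on {a..b}"
    using g by (auto simp: absolutely_integrable_on_def)
  have cG: "continuous_on {a..b} G"
  proof (rule continuous_on_eq)
    show "continuous_on {a..b} (\<lambda>x. G a + integral {a..x} g)"
      by (intro continuous_on_add continuous_on_const indefinite_integral_continuous_1 gi)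
  qed (rule G[symmetric])
  show ai: "(\<lambda>x. h (u x) (g x)) absolutely_integrable_on {a..b}"
    by (rule absolutely_integrable_bounded_measurable_product)
      (auto simp: h bilinear_conv_bounded_bilinear g intro!: continuous_imp_measurable_on_sets_lebesgue cu
        compact_imp_bounded compact_continuous_image)
  define k where "k s = h (u s) (g s) + h (u' s) (G s)" for s
  have ki: "k integrable_on {a..b}"
    unfolding k_def
    by (rule integrable_add[OF set_lebesgue_integral_eq_integral(1)[OF ai] integrable_continuous_real])
      (intro h.continuous_on cu' cG)
  define J where "J x = integral {a..x} k" for x
  define H where "H x = integral {a..x} (\<lambda>s. norm (g s))" for x
  define P where "P x = h (u x) (G x) - J x" for x
  have cH: "continuous_on {a..b} H"
    unfolding H_def by (intro indefinite_integral_continuous_1 ngi)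
  have diff: "(f has_integral integral {a..y} f - integral {a..x} f) {x..y}"
    if "f integrable_on {a..b}" "a \<le> x" "x \<le> y" "y \<le> b" for f :: "real \<Rightarrow> 'd::euclidean_space" and x y
  proof -
    have "f integrable_on {a..y}" "f integrable_on {x..y}"
      using that by (auto intro: integrable_on_subinterval)
    then show ?thesis
      using Henstock_Kurzweil_Integration.integral_combine[OF that(2,3), of f] that by (auto simp: has_integral_iff algebra_simps)
  qed
  have key: "norm (P y - P x) \<le> 2 * K * L * (y - x) * (H y - H x)"
    if xy: "a \<le> x" "x \<le> y" "y \<le> b" for x y
  proof -
    have gd: "(g has_integral G z - G x) {x..z}" if "z \<in> {x..y}" for z
      using diff[OF gi, of x z] G[of x] G[of z] xy that by auto
    have hd: "((\<lambda>s. norm (g s)) has_integral H z - H x) {x..z}" if "z \<in> {x..y}" for z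
      using diff[OF ngi, of x z] xy that unfolding H_def by auto
    have ud: "(u' has_integral u z - u w) {w..z}" if "x \<le> w" "w \<le> z" "z \<le> y" for w z
      by (rule fundamental_theorem_of_calculus)
        (use that xy in \<open>auto intro: has_vector_derivative_within_subset[OF u]\<close>)
    have lip: "norm (u y - u s) \<le> L * (y - x)" if "s \<in> {x..y}" for s
    proof -
      have "norm (u y - u s) \<le> L * (y - s)"
        using has_integral_bound[of L u' "u y - u s" s y] ud[of s y] that L xy \<open>L > 0\<close> by auto
      also have "\<dots> \<le> L * (y - x)"
        using that \<open>L > 0\<close> by auto
      finally show ?thesis .
    qed
    have Gb: "norm (G x - G s) \<le> H y - H x" if s: "s \<in> {x..y}" for s
    proof -
      have "norm (G s - G x) \<le> H s - H x"
        using integral_norm_bound_integral[of g "{x..s}" "\<lambda>s. norm (g s)"] gd[OF s] hd[OF s]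
        by (auto simp: has_integral_iff)
      also have "\<dots> \<le> H y - H x"
        using has_integral_nonneg[OF diff[OF ngi, of s y]] s xy unfolding H_def by auto
      finally show ?thesis by (simp add: norm_minus_commute)
    qed
    have i1: "((\<lambda>s. h (u y) (g s)) has_integral h (u y) (G y - G x)) {x..y}"
      using has_integral_linear[OF gd h.bounded_linear_right] xy by (auto simp: o_def)
    have i2: "((\<lambda>s. h (u' s) (G x)) has_integral h (u y - u x) (G x)) {x..y}"
      using has_integral_linear[OF ud h.bounded_linear_left] xy by (auto simp: o_def)
    have i3: "(k has_integral J y - J x) {x..y}"
      unfolding J_def by (rule diff) (use ki xy in auto)
    have "((\<lambda>s. h (u y - u s) (g s) + h (u' s) (G x - G s)) has_integral P y - P x) {x..y}"
      using has_integral_diff[OF has_integral_add[OF i1 i2] i3]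
      by (simp add: k_def P_def h.diff_left h.diff_right algebra_simps)
    moreover have "((\<lambda>s. K * L * (y - x) * norm (g s) + K * L * (H y - H x)) has_integral
        K * L * (y - x) * (H y - H x) + (y - x) * (K * L * (H y - H x))) {x..y}"
      using has_integral_add[OF has_integral_mult_right[OF hd[of y], of "K * L * (y - x)"]
        has_integral_const_real[of "K * L * (H y - H x)" x y]] xy
      by (simp add: algebra_simps)
    moreover have "norm (h (u y - u s) (g s) + h (u' s) (G x - G s))
        \<le> K * L * (y - x) * norm (g s) + K * L * (H y - H x)" if s: "s \<in> {x..y}" for s
    proof (rule norm_triangle_mono)
      have "norm (h (u y - u s) (g s)) \<le> norm (u y - u s) * norm (g s) * K" by (rule K)
      also have "\<dots> \<le> L * (y - x) * norm (g s) * K"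
        using lip[OF s] K by (intro mult_right_mono) auto
      finally show "norm (h (u y - u s) (g s)) \<le> K * L * (y - x) * norm (g s)"
        by (simp add: mult_ac)
      have "norm (h (u' s) (G x - G s)) \<le> norm (u' s) * norm (G x - G s) * K" by (rule K)
      also have "\<dots> \<le> L * (H y - H x) * K"
        using Gb[OF s] K L[of s] s xy \<open>L > 0\<close> by (intro mult_right_mono mult_mono) auto
      finally show "norm (h (u' s) (G x - G s)) \<le> K * L * (H y - H x)"
        by (simp add: mult_ac)
    qed
    ultimately have "norm (P y - P x) \<le> K * L * (y - x) * (H y - H x) + (y - x) * (K * L * (H y - H x))"
      using integral_norm_bound_integral[of "\<lambda>s. h (u y - u s) (g s) + h (u' s) (G x - G s)" "{x..y}"
          "\<lambda>s. K * L * (y - x) * norm (g s) + K * L * (H y - H x)"]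
      by (auto simp: has_integral_iff)
    then show ?thesis by (simp add: algebra_simps)
  qed
  have key': "norm (P y - P x) \<le> 2 * K * L * \<bar>H y - H x\<bar> * \<bar>y - x\<bar>"
    if "x \<in> {a..b}" "y \<in> {a..b}" for x y
  proof -
    have *: "norm (P y - P x) \<le> 2 * K * L * \<bar>H y - H x\<bar> * \<bar>y - x\<bar>"
      if "a \<le> x" "x \<le> y" "y \<le> b" for x y
    proof -
      have "norm (P y - P x) \<le> 2 * K * L * (y - x) * (H y - H x)" by (rule key[OF that])
      also have "\<dots> \<le> 2 * K * L * (y - x) * \<bar>H y - H x\<bar>"
        using K \<open>L > 0\<close> that by (intro mult_left_mono) auto
      also have "\<dots> = 2 * K * L * \<bar>H y - H x\<bar> * \<bar>y - x\<bar>"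
        using that by (simp only: abs_of_nonneg diff_ge_0_iff_ge mult_ac)
      finally show ?thesis .
    qed
    show ?thesis
      using *[of x y] *[of y x] that
      by (cases "x \<le> y") (auto simp: norm_minus_commute abs_minus_commute)
  qed
  have "(P has_derivative (\<lambda>h. 0)) (at x within {a..b})" if x: "x \<in> {a..b}" for x
    unfolding has_derivative_iff_norm
  proof (intro conjI)
    have "((\<lambda>y. 2 * K * L * \<bar>H y - H x\<bar>) \<longlongrightarrow> 2 * K * L * \<bar>H x - H x\<bar>) (at x within {a..b})"
      using cH x by (intro tendsto_intros) (auto simp: continuous_on_def)
    then have lim: "((\<lambda>y. 2 * K * L * \<bar>H y - H x\<bar>) \<longlongrightarrow> 0) (at x within {a..b})" by simp
    show "((\<lambda>y. norm (P y - P x - 0) / norm (y - x)) \<longlongrightarrow> 0) (at x within {a..b})"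
    proof (rule Lim_null_comparison[OF _ lim])
      show "\<forall>\<^sub>F y in at x within {a..b}. norm (norm (P y - P x - 0) / norm (y - x)) \<le> 2 * K * L * \<bar>H y - H x\<bar>"
        unfolding eventually_at_filter
        by (intro always_eventually) (use key'[OF x] in \<open>auto simp: divide_le_eq\<close>)
    qed
  qed auto
  then have "P b = P a"
    using ab by (intro has_derivative_zero_unique[of "{a..b}"]) auto
  then show "((\<lambda>x. h (u x) (g x) + h (u' x) (G x)) has_integral h (u b) (G b) - h (u a) (G a)) {a..b}"
    using ki unfolding k_def[symmetric] P_def J_def by (simp add: has_integral_iff algebra_simps)
qed

text \<open>
  The test function is an antiderivative of a difference of two bumps of equal mass, one near \<open>x\<close>,
  where \<open>w\<close> is above the level \<open>m\<close>, and one near \<open>y\<close>, where it is below.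
\<close>

lemma du_Bois_Reymond:
  fixes w :: "real \<Rightarrow> real"
  assumes w: "continuous_on {0..1} w"
    and orth: "\<And>\<psi>. test_function \<psi> \<Longrightarrow> integral {0..1} (\<lambda>x. deriv \<psi> x * w x) = 0"
    and x: "x \<in> {0<..<1}" and y: "y \<in> {0<..<1}"
  shows "w x \<le> w y"
proof (rule ccontr)
  assume "\<not> w x \<le> w y"
  define m where "m = (w x + w y) / 2"
  have m: "w y < m" "m < w x" using \<open>\<not> w x \<le> w y\<close> by (auto simp: m_def)
  have cw: "isCont w z" if "z \<in> {0<..<1}" for z
    using continuous_on_interior[OF w] that by (simp add: interior_atLeastAtMost_real)
  have near: "\<exists>a b. 0 < a \<and> a < z \<and> z < b \<and> b < 1 \<and> (\<forall>t\<in>{a<..<b}. Q (w t))"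
    if z: "z \<in> {0<..<1}" and "open {r. Q r}" "Q (w z)" for z Q
  proof -
    have "\<forall>\<^sub>F t in nhds z. w t \<in> {r. Q r}"
      using cw[OF z] that by (intro topological_tendstoD[of w "w z"]) (auto simp: isCont_def tendsto_at_iff_tendsto_nhds)
    then obtain d where d: "d > 0" "\<And>t. dist t z < d \<Longrightarrow> Q (w t)"
      by (auto simp: eventually_nhds_metric)
    define e where "e = min d (min (z / 2) ((1 - z) / 2))"
    have e: "e > 0" "e \<le> d" "e \<le> z / 2" "e \<le> (1 - z) / 2" using d z unfolding e_def by (simp, linarith+)
    show ?thesis
      by (rule exI[of _ "z - e"], rule exI[of _ "z + e"])
        (use e z d in \<open>auto simp: dist_real_def abs_less_iff\<close>)
  qed
  obtain a b where ab: "0 < a" "a < x" "x < b" "b < 1" "\<And>t. t \<in> {a<..<b} \<Longrightarrow> m < w t"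
    using near[OF x, of "\<lambda>r. m < r"] m by (auto simp flip: greaterThan_def)
  obtain c d where cd: "0 < c" "c < y" "y < d" "d < 1" "\<And>t. t \<in> {c<..<d} \<Longrightarrow> w t < m"
    using near[OF y, of "\<lambda>r. r < m"] m by (auto simp flip: lessThan_def)
  have "a < b" "c < d" using ab cd by auto
  obtain A :: "nat \<Rightarrow> real \<Rightarrow> real" where A: "\<And>k x. (A k has_real_derivative A (Suc k) x) (at x)"
    "\<And>x. x \<in> {a<..<b} \<Longrightarrow> A 0 x > 0" "\<And>x. x \<notin> {a<..<b} \<Longrightarrow> A 0 x = 0"
    using bump_seq[OF \<open>a < b\<close>] by metis
  obtain B :: "nat \<Rightarrow> real \<Rightarrow> real" where B: "\<And>k x. (B k has_real_derivative B (Suc k) x) (at x)"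
    "\<And>x. x \<in> {c<..<d} \<Longrightarrow> B 0 x > 0" "\<And>x. x \<notin> {c<..<d} \<Longrightarrow> B 0 x = 0"
    using bump_seq[OF \<open>c < d\<close>] by metis
  have contA: "continuous_on S (A 0)" and contB: "continuous_on S (B 0)" for S
    by (rule DERIV_continuous_on, rule has_field_derivative_at_within, rule A(1) B(1))+
  have int_pos: "integral {0..1} f > 0"
    if "continuous_on {0..1} f" "\<And>t. f t \<ge> 0" "f z > 0" "z \<in> {0<..<1}" for f :: "real \<Rightarrow> real" and z
  proof -
    have "integral {0..1} f \<ge> 0" by (intro integral_nonneg integrable_continuous_real that)
    moreover have "integral {0..1} f \<noteq> 0"
    proof
      assume "integral {0..1} f = 0"
      then have "\<forall>t\<in>{0..1}. f t = 0" using integral_eq_0_iff[of 0 1 f] that by auto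
      then show False using that(3,4) by force
    qed
    ultimately show ?thesis by simp
  qed
  define \<alpha> where "\<alpha> = integral {0..1} (A 0)"
  define \<beta> where "\<beta> = integral {0..1} (B 0)"
  have A0: "A 0 t \<ge> 0" and B0: "B 0 t \<ge> 0" for t
    using A(2,3)[of t] B(2,3)[of t] by (cases "t \<in> {a<..<b}"; cases "t \<in> {c<..<d}"; force)+
  have \<alpha>: "\<alpha> > 0" unfolding \<alpha>_def by (rule int_pos[of _ x]) (use contA A0 A(2)[of x] ab x in auto)
  have \<beta>: "\<beta> > 0" unfolding \<beta>_def by (rule int_pos[of _ y]) (use contB B0 B(2)[of y] cd y in auto)
  define \<eta> where "\<eta> k t = A k t / \<alpha> - B k t / \<beta>" for k t
  have \<eta>: "(\<eta> k has_real_derivative \<eta> (Suc k) t) (at t)" for k t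
    unfolding \<eta>_def by (intro DERIV_diff DERIV_cdivide A(1) B(1))
  have cont\<eta>: "continuous_on S (\<eta> 0)" for S
    by (rule DERIV_continuous_on[OF has_field_derivative_at_within[OF \<eta>]])
  have "\<exists>F. \<forall>t. ereal t > -\<infinity> \<longrightarrow> ereal t < \<infinity> \<longrightarrow> (F has_vector_derivative \<eta> 0 t) (at t)"
    using cont\<eta>[of UNIV] by (intro einterval_antiderivative) (auto simp: continuous_on_eq_continuous_at)
  then obtain F where F: "\<And>t. (F has_real_derivative \<eta> 0 t) (at t)"
    by (auto simp: has_real_derivative_iff_has_vector_derivative)
  define \<psi> where "\<psi> k t = (if k = 0 then F t - F 0 else \<eta> (k - 1) t)" for k t
  have \<psi>: "(\<psi> k has_real_derivative \<psi> (Suc k) t) (at t)" for k t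
    by (cases k) (auto simp: \<psi>_def[abs_def] intro!: derivative_eq_intros F \<eta>)
  have FTC: "(\<eta> 0 has_integral F t - F s) {s..t}" if "s \<le> t" for s t
    using that F by (intro fundamental_theorem_of_calculus)
      (auto simp: has_real_derivative_iff_has_vector_derivative intro: has_vector_derivative_at_within)
  have "integral {0..1} (\<eta> 0) = 0"
    unfolding \<eta>_def using \<alpha> \<beta>
    by (subst integral_diff) (auto simp: \<alpha>_def \<beta>_def intro!: integrable_continuous_real continuous_intros contA contB)
  then have F1: "F 1 = F 0" using FTC[of 0 1] by (simp add: has_integral_iff)
  define lo hi where "lo = min a c" and "hi = max b d"
  have lo: "0 < lo" "lo \<le> a" "lo \<le> c" and hi: "b \<le> hi" "d \<le> hi" "hi < 1"
    using ab cd by (auto simp: lo_def hi_def)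
  have \<eta>0: "\<eta> 0 t = 0" if "t \<notin> {lo..hi}" for t
  proof -
    have "t \<notin> {a<..<b}" "t \<notin> {c<..<d}" using that lo hi by auto
    then show ?thesis using A(3) B(3) by (simp add: \<eta>_def)
  qed
  have const: "F t = F s" if "s \<le> t" "t < lo \<or> hi < s" for s t
  proof -
    have "(\<eta> 0 has_integral 0) {s..t}"
    proof (rule has_integral_is_0)
      fix r assume "r \<in> {s..t}"
      then have "r \<notin> {lo..hi}" using that by auto
      then show "\<eta> 0 r = 0" by (rule \<eta>0)
    qed
    from has_integral_unique[OF FTC[OF that(1)] this] show ?thesis by simp
  qed
  have "\<psi> 0 t = 0" if "t \<notin> {lo..hi}" for t
  proof -
    have "F t = F 0"
    proof (cases "t < lo")
      case True
      then show ?thesis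
        using const[of "min t 0" "max t 0"] lo by (cases "t \<le> 0") simp_all
    next
      case False
      then have "F (max t 1) = F (min t 1)"
        using const[of "min t 1" "max t 1"] that hi by auto
      then show ?thesis using F1 by (auto simp: min_def max_def split: if_splits)
    qed
    then show ?thesis by (simp add: \<psi>_def)
  qed
  then have "test_function (\<psi> 0)"
    by (intro test_function_seqI[of \<psi> lo hi] \<psi>) (use lo hi in auto)
  moreover have "deriv (\<psi> 0) = \<eta> 0"
    using \<psi>[of 0] by (auto simp: \<psi>_def intro!: DERIV_imp_deriv)
  ultimately have orth': "integral {0..1} (\<lambda>t. \<eta> 0 t * w t) = 0"
    using orth[of "\<psi> 0"] by simp
  have "integral {0..1} (\<lambda>t. \<eta> 0 t * (w t - m)) = integral {0..1} (\<lambda>t. \<eta> 0 t * w t) - integral {0..1} (\<lambda>t. \<eta> 0 t * m)"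
    unfolding right_diff_distrib
    by (intro integral_diff integrable_continuous_real continuous_intros cont\<eta> w)
  also have "\<dots> = 0"
    using orth' \<open>integral {0..1} (\<eta> 0) = 0\<close> by simp
  finally have zero: "integral {0..1} (\<lambda>t. \<eta> 0 t * (w t - m)) = 0" .
  have nonneg: "\<eta> 0 t * (w t - m) \<ge> 0" for t
  proof -
    have "A 0 t * (w t - m) \<ge> 0"
      using A(3)[of t] A0[of t] ab(5)[of t] by (cases "t \<in> {a<..<b}") auto
    moreover have "B 0 t * (w t - m) \<le> 0"
      using B(3)[of t] B0[of t] cd(5)[of t] by (cases "t \<in> {c<..<d}") (auto intro!: mult_nonneg_nonpos)
    ultimately have "A 0 t * (w t - m) / \<alpha> \<ge> 0" "B 0 t * (w t - m) / \<beta> \<le> 0"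
      using \<alpha> \<beta> by (auto simp: divide_nonpos_pos)
    then show ?thesis by (simp add: \<eta>_def algebra_simps)
  qed
  have "\<forall>t\<in>{0..1}. \<eta> 0 t * (w t - m) = 0"
  proof (rule iffD1[OF integral_eq_0_iff zero])
    show "continuous_on {0..1} (\<lambda>t. \<eta> 0 t * (w t - m))"
      by (intro continuous_intros cont\<eta> w)
  qed (use nonneg in auto)
  then have "\<eta> 0 x * (w x - m) = 0" using x by force
  then have "A 0 x / \<alpha> = B 0 x / \<beta>" using m by (auto simp: \<eta>_def)
  moreover have "A 0 x / \<alpha> > 0" using A(2)[of x] ab \<alpha> by simp
  ultimately have "B 0 x \<noteq> 0" by auto
  then have "x \<in> {c<..<d}" using B(3)[of x] by blast
  then show False using cd(5)[of x] m by simp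
qed

section \<open>Quadratic forms on the plane\<close>

lemma cinner2_self: "cinner2 v v = of_real ((norm (v $ 1))\<^sup>2 + (norm (v $ 2))\<^sup>2)"
  by (simp add: cinner2_def sum_2 complex_norm_square del: of_real_power)

lemma cinner2_mult: "cinner2 (A *v v) v = A $ 1 $ 1 * (v $ 1 * cnj (v $ 1)) + A $ 1 $ 2 * (v $ 2 * cnj (v $ 1))
    + A $ 2 $ 1 * (v $ 1 * cnj (v $ 2)) + A $ 2 $ 2 * (v $ 2 * cnj (v $ 2))"
  by (simp add: cinner2_def sum_2 matrix_vector_mult_def algebra_simps)

text \<open>
  \<open>P\<close>, \<open>Q\<close>, \<open>W\<close> are the entries of a positive semidefinite matrix. It is moved along a line on which the
  value and the trace are constant until the determinant \<open>\<Delta>\<close> vanishes.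
\<close>

lemma rank_one_same_value:
  fixes a b d W :: complex
  assumes "P \<ge> 0" "Q \<ge> 0" "(norm W)\<^sup>2 \<le> P * Q"
  obtains p q :: real and w :: complex
  where "p \<ge> 0" "q \<ge> 0" "(norm w)\<^sup>2 = p * q"
    "a * of_real p + d * of_real q + b * w = a * of_real P + d * of_real Q + b * W"
proof (cases "b = 0")
  case True
  then show ?thesis
    using that[of P Q "of_real (sqrt (P * Q))"] assms by simp
next
  case False
  define w where "w t = W + of_real t * ((d - a) / b)" for t :: real
  define \<Delta> where "\<Delta> t = (P + t) * (Q - t) - (norm (w t))\<^sup>2" for t
  have "\<exists>t\<ge>0. t \<le> Q \<and> \<Delta> t = 0"
    by (rule IVT2') (use assms False in \<open>auto simp: \<Delta>_def w_def intro!: continuous_intros\<close>)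
  then obtain t where t: "t \<ge> 0" "t \<le> Q" "\<Delta> t = 0" by blast
  show ?thesis
    by (rule that[of "P + t" "Q - t" "w t"])
      (use assms t False in \<open>auto simp: \<Delta>_def w_def field_simps\<close>)
qed

lemma mem_rays_Num_matrix:
  fixes w :: complex
  assumes "p \<ge> 0" "q \<ge> 0" "(norm w)\<^sup>2 = p * q" "A $ 2 $ 1 = 0"
  shows "A $ 1 $ 1 * of_real p + A $ 2 $ 2 * of_real q + A $ 1 $ 2 * w \<in> rays (Num_matrix A)"
proof -
  have "\<exists>x y :: complex. x * cnj x = of_real p \<and> y * cnj y = of_real q \<and> y * cnj x = w"
  proof (cases "p = 0")
    case True
    then show ?thesis using assms
      by (intro exI[of _ 0] exI[of _ "of_real (sqrt q)"]) (simp flip: of_real_mult)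
  next
    case False
    then have "p > 0" using assms by simp
    have "(of_real (sqrt p) :: complex) * of_real (sqrt p) = of_real p"
      using \<open>p > 0\<close> by (simp flip: of_real_mult)
    moreover have "w * cnj w = of_real p * of_real q"
      using assms by (simp flip: of_real_mult add: complex_norm_square[symmetric])
    ultimately show ?thesis using \<open>p > 0\<close>
      by (intro exI[of _ "of_real (sqrt p)"] exI[of _ "w / of_real (sqrt p)"]) simp
  qed
  then obtain x y :: complex where xy: "x * cnj x = of_real p" "y * cnj y = of_real q" "y * cnj x = w"
    by blast
  define r where "r = sqrt (p + q)"
  define v :: "complex ^ 2" where "v = (if r = 0 then vector [1, 0] else vector [x / of_real r, y / of_real r])"
  have r2: "r * r = p + q" using assms by (simp add: r_def)
  have pq: "(norm x)\<^sup>2 = p" "(norm y)\<^sup>2 = q"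
    using xy by (simp_all only: complex_norm_square[symmetric] of_real_eq_iff)
  have "(norm (v $ 1))\<^sup>2 + (norm (v $ 2))\<^sup>2 = 1"
    using r2 pq by (auto simp: v_def norm_divide power_divide power2_eq_square simp flip: add_divide_distrib)
  then have "cinner2 (A *v v) v \<in> Num_matrix A"
    by (force simp: Num_matrix_def numerical_range_def cinner2_self)
  moreover have "A $ 1 $ 1 * of_real p + A $ 2 $ 2 * of_real q + A $ 1 $ 2 * w
      = of_real (r * r) * cinner2 (A *v v) v"
  proof (cases "r = 0")
    case True
    then have "p = 0" "q = 0" using assms r2 by auto
    then show ?thesis using assms True by simp
  next
    case False
    then have "cinner2 (A *v v) v = (A $ 1 $ 1 * (x * cnj x) + A $ 1 $ 2 * (y * cnj x) + A $ 2 $ 2 * (y * cnj y)) / of_real (r * r)"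
      using assms by (simp add: cinner2_mult v_def add_divide_distrib)
    then show ?thesis using False xy by simp
  qed
  ultimately show ?thesis
    unfolding rays_def using r2 assms by (auto intro!: exI[of _ "r * r"])
qed

lemma norm_le_of_nonneg_form:
  fixes W :: complex
  assumes "\<And>s t :: complex. P * (norm s)\<^sup>2 + Q * (norm t)\<^sup>2 + 2 * Re (s * t * W) \<ge> 0"
  shows "P \<ge> 0" "Q \<ge> 0" "(norm W)\<^sup>2 \<le> P * Q"
proof -
  show P: "P \<ge> 0" using assms[of 1 0] by simp
  show Q: "Q \<ge> 0" using assms[of 0 1] by simp
  have W: "W * cnj W = of_real ((norm W)\<^sup>2)" by (rule complex_norm_square[symmetric])
  have form: "P * (r * norm W)\<^sup>2 + Q * t\<^sup>2 + 2 * r * t * (norm W)\<^sup>2 \<ge> 0" for r t :: real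
  proof -
    have "of_real r * cnj W * of_real t * W = of_real r * of_real t * (W * cnj W)"
      by simp
    also have "\<dots> = of_real (r * t * (norm W)\<^sup>2)"
      by (simp only: W of_real_mult)
    finally have "Re (of_real r * cnj W * of_real t * W) = r * t * (norm W)\<^sup>2"
      by (simp only: Re_complex_of_real)
    with assms[of "of_real r * cnj W" "of_real t"] show ?thesis
      unfolding norm_mult power_mult_distrib by simp
  qed
  show "(norm W)\<^sup>2 \<le> P * Q"
  proof (cases "W = 0")
    case True
    then show ?thesis using P Q by simp
  next
    case False
    then have n: "(norm W)\<^sup>2 > 0" by simp
    have "(norm W)\<^sup>2 * (P * r\<^sup>2 + 2 * r * t) + Q * t\<^sup>2 \<ge> 0" for r t
      using form[of r t] by (simp add: algebra_simps power_mult_distrib)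
    from this[of "-1" P] have "P * (P * Q - (norm W)\<^sup>2) \<ge> 0"
      by (simp add: algebra_simps power2_eq_square)
    moreover have "P \<noteq> 0"
    proof
      assume "P = 0"
      then show False
        using form[of "- (Q + 1) / (2 * (norm W)\<^sup>2)" 1] n by (simp add: field_simps)
    qed
    ultimately show ?thesis using P by (simp add: zero_le_mult_iff)
  qed
qed

lemma small_quadratic_fixed_point:
  fixes c z :: complex
  assumes "c \<noteq> 0"
  obtains e where "e > 0" "\<And>\<eta>. norm \<eta> \<le> e \<Longrightarrow> \<exists>\<delta>. \<eta> * of_real ((norm \<delta>)\<^sup>2) - c * \<delta> = z"
proof -
  define R where "R = (norm z + 1) / norm c"
  have R: "R > 0" using assms by (simp add: R_def add_nonneg_pos)
  show ?thesis
  proof (rule that[of "1 / R\<^sup>2"])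
    fix \<eta> :: complex assume \<eta>: "norm \<eta> \<le> 1 / R\<^sup>2"
    have "norm ((\<eta> * of_real ((norm \<delta>)\<^sup>2) - z) / c) \<le> R" if "norm \<delta> \<le> R" for \<delta> :: complex
    proof -
      have "norm (\<eta> * of_real ((norm \<delta>)\<^sup>2)) \<le> 1 / R\<^sup>2 * R\<^sup>2"
        unfolding norm_mult using \<eta> that R
        by (intro mult_mono) (auto intro: power_mono simp del: of_real_power)
      then have "norm (\<eta> * of_real ((norm \<delta>)\<^sup>2) - z) \<le> 1 + norm z"
        using norm_triangle_ineq4[of "\<eta> * of_real ((norm \<delta>)\<^sup>2)" z] R by simp
      then show ?thesis using assms by (simp add: R_def norm_divide divide_right_mono add.commute)
    qed
    moreover have "continuous_on (cball 0 R) (\<lambda>\<delta>. (\<eta> * of_real ((norm \<delta>)\<^sup>2) - z) / c)"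
      using assms by (intro continuous_intros) auto
    ultimately obtain \<delta> where "(\<eta> * of_real ((norm \<delta>)\<^sup>2) - z) / c = \<delta>"
      using brouwer_ball[OF R, of 0 "\<lambda>\<delta>. (\<eta> * of_real ((norm \<delta>)\<^sup>2) - z) / c"] by fastforce
    then show "\<exists>\<delta>. \<eta> * of_real ((norm \<delta>)\<^sup>2) - c * \<delta> = z"
      using assms by (intro exI[of _ \<delta>]) (auto simp: field_simps)
  qed (use R in auto)
qed

lemma trig_period_integrals:
  fixes n :: nat
  assumes "n > 0" and w: "w = 2 * pi * real n"
  shows "((\<lambda>t. (sin (w * t))\<^sup>2) has_integral 1 / 2) {0..1}"
    and "((\<lambda>t. (cos (w * t))\<^sup>2) has_integral 1 / 2) {0..1}"
    and "((\<lambda>t. cos (w * t)) has_integral 0) {0..1}"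
proof -
  have w0: "w \<noteq> 0" using assms by simp
  have s: "sin w = 0" "sin (2 * w) = 0"
    using sin_npi2[of "2 * n"] sin_npi2[of "4 * n"] by (simp_all add: w mult_ac)
  have FTC: "(f has_integral F 1 - F 0) {0..1}"
    if "\<And>t. (F has_real_derivative f t) (at t)" for F f :: "real \<Rightarrow> real"
    using that by (intro fundamental_theorem_of_calculus)
      (auto simp: has_real_derivative_iff_has_vector_derivative intro: has_vector_derivative_at_within)
  have d: "cos (2 * (w * t)) = 1 - 2 * (sin (w * t))\<^sup>2" "cos (2 * (w * t)) = 2 * (cos (w * t))\<^sup>2 - 1" for t
    using cos_double_sin[of "w * t"] cos_double_cos[of "w * t"] by auto
  have "((\<lambda>t. t / 2 - sin (2 * (w * t)) / (4 * w)) has_real_derivative (1 - cos (2 * (w * t))) / 2) (at t)" for t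
    using w0 by (auto intro!: derivative_eq_intros simp: field_simps)
  then have "((\<lambda>t. t / 2 - sin (2 * (w * t)) / (4 * w)) has_real_derivative (sin (w * t))\<^sup>2) (at t)" for t
    by (simp add: d(1))
  from FTC[OF this] show "((\<lambda>t. (sin (w * t))\<^sup>2) has_integral 1 / 2) {0..1}"
    using s by simp
  have "((\<lambda>t. t / 2 + sin (2 * (w * t)) / (4 * w)) has_real_derivative (1 + cos (2 * (w * t))) / 2) (at t)" for t
    using w0 by (auto intro!: derivative_eq_intros simp: field_simps)
  then have "((\<lambda>t. t / 2 + sin (2 * (w * t)) / (4 * w)) has_real_derivative (cos (w * t))\<^sup>2) (at t)" for t
    by (simp add: d(2))
  from FTC[OF this] show "((\<lambda>t. (cos (w * t))\<^sup>2) has_integral 1 / 2) {0..1}"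
    using s by simp
  have "((\<lambda>t. sin (w * t) / w) has_real_derivative cos (w * t)) (at t)" for t
    using w0 by (auto intro!: derivative_eq_intros)
  from FTC[OF this] show "((\<lambda>t. cos (w * t)) has_integral 0) {0..1}"
    using s by simp
qed

section \<open>The Sobolev domain\<close>

lemma integrable_I01_iff:
  fixes f :: "real \<Rightarrow> 'a::euclidean_space"
  shows "integrable I01 f \<longleftrightarrow> f absolutely_integrable_on {0..1}"
  by (subst absolutely_integrable_on_Icc_iff_Ioo) (simp add: set_integrable_def integrable_restrict_space)

lemma integral_I01:
  fixes f :: "real \<Rightarrow> 'a::euclidean_space"
  assumes "f absolutely_integrable_on {0..1}"
  shows "(LINT x|I01. f x) = integral {0..1} f"
  using assms by (simp add: lebesgue_integral_eq_integral integrable_I01_iff integral_open_interval_real)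

lemma continuous_measurable_I01:
  fixes f :: "real \<Rightarrow> 'a::euclidean_space"
  assumes "continuous_on {0..1} f"
  shows "f \<in> borel_measurable I01"
  using assms by (intro continuous_imp_measurable_on_sets_lebesgue) (auto intro: continuous_on_subset)

lemma L2_absolutely_integrable:
  assumes "f \<in> L2"
  shows "f absolutely_integrable_on {0..1}"
proof -
  have f: "f \<in> borel_measurable I01" "integrable I01 (\<lambda>x. (norm (f x))\<^sup>2)"
    using assms by (auto simp: L2_def)
  have "integrable I01 (\<lambda>x. 1 + (norm (f x))\<^sup>2)"
    using f by (intro Bochner_Integration.integrable_add) (simp_all add: integrable_I01_iff absolutely_integrable_continuous_real)
  then have "integrable I01 f"
  proof (rule Bochner_Integration.integrable_bound[OF _ f(1)])
    have "norm (f x) \<le> 1 + (norm (f x))\<^sup>2" for x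
          proof -
      have "2 * norm (f x) \<le> (norm (f x))\<^sup>2 + 1"
        using zero_le_power2[of "norm (f x) - 1"] by (simp add: power2_diff)
      then show ?thesis using norm_ge_zero[of "f x"] by linarith
    qed
    then show "AE x in I01. norm (f x) \<le> norm (1 + (norm (f x))\<^sup>2)" by auto
  qed
  then show ?thesis by (simp add: integrable_I01_iff)
qed

lemma continuous_L2:
  assumes "continuous_on {0..1} f"
  shows "f \<in> L2"
  unfolding L2_def using assms
  by (auto simp: integrable_I01_iff continuous_measurable_I01
      intro!: absolutely_integrable_continuous_real continuous_intros)

lemma test_function_deriv:
  assumes "test_function \<psi>"
  shows "(\<psi> has_real_derivative deriv \<psi> x) (at x)"
    "(deriv \<psi> has_real_derivative deriv (deriv \<psi>) x) (at x)"
    "continuous_on S (deriv \<psi>)" "continuous_on S (deriv (deriv \<psi>))"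
proof -
  have "(deriv ^^ k) \<psi> differentiable at x" for k x
    using assms by (simp add: test_function_def differentiable_on_def)
  from this[of 0] this[of 1] this[of 2]
  have *: "\<psi> differentiable at x" "deriv \<psi> differentiable at x"
    "deriv (deriv \<psi>) differentiable at x" for x
    by (simp_all add: numeral_2_eq_2)
  show "(\<psi> has_real_derivative deriv \<psi> x) (at x)"
    "(deriv \<psi> has_real_derivative deriv (deriv \<psi>) x) (at x)"
    using * by (simp_all add: DERIV_deriv_iff_real_differentiable)
  show "continuous_on S (deriv \<psi>)" "continuous_on S (deriv (deriv \<psi>))"
    using * by (simp_all add: continuous_at_imp_continuous_on differentiable_imp_continuous_within)
qed

lemma test_function_boundary:
  assumes "test_function \<psi>" "x \<notin> {0<..<1}"
  shows "\<psi> x = 0" "deriv \<psi> x = 0"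
proof -
  let ?U = "- closure {x. \<psi> x \<noteq> 0}"
  have x: "x \<in> ?U" using assms by (auto simp: test_function_def)
  have U: "\<psi> y = 0" if "y \<in> ?U" for y
    using that closure_subset[of "{x. \<psi> x \<noteq> 0}"] by auto
  show "\<psi> x = 0" by (rule U[OF x])
  have "(\<psi> has_real_derivative 0) (at x)"
  proof (rule has_field_derivative_transform_within_open)
    show "((\<lambda>_. 0) has_real_derivative 0) (at x)" by simp
    show "open ?U" by (intro open_Compl closed_closure)
  qed (rule x, rule U[symmetric])
  then show "deriv \<psi> x = 0" by (rule DERIV_imp_deriv)
qed

lemma W22_deriv_eq_integral:
  assumes f: "f \<in> L2" and g: "g \<in> L2" and fg: "gen_deriv2 f g" and F: "C1_rep f F F'"
    and t: "t \<in> {0..1}"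
  shows "F' t = F' 0 + integral {0..t} g"
proof -
  have dF: "\<And>x. x \<in> {0..1} \<Longrightarrow> (F has_vector_derivative F' x) (at x within {0..1})"
    and cF': "continuous_on {0..1} F'" and FAE: "AE x in I01. F x = f x"
    using F by (auto simp: C1_rep_def)
  have cF: "continuous_on {0..1} F"
    by (rule continuous_on_vector_derivative[OF dF])
  have ag: "g absolutely_integrable_on {0..1}" by (rule L2_absolutely_integrable[OF g])
  define G where "G x = integral {0..x} g" for x
  have cG: "continuous_on {0..1} G"
    unfolding G_def using ag by (intro indefinite_integral_continuous_1) (auto simp: absolutely_integrable_on_def)
  have main: "integral {0..1} (\<lambda>x. deriv \<psi> x *\<^sub>R (F' x - G x)) = 0" if \<psi>: "test_function \<psi>" for \<psi>
  proof -
    note d = test_function_deriv[OF \<psi>]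
    note b = test_function_boundary[OF \<psi>]
    have vd: "(\<psi> has_vector_derivative deriv \<psi> x) (at x within {0..1})"
      "(deriv \<psi> has_vector_derivative deriv (deriv \<psi>) x) (at x within {0..1})" for x
      using d(1,2) by (simp_all add: has_real_derivative_iff_has_vector_derivative[symmetric] has_field_derivative_at_within)
    have i1: "((\<lambda>x. deriv \<psi> x *\<^sub>R F' x + deriv (deriv \<psi>) x *\<^sub>R F x) has_integral
        deriv \<psi> 1 *\<^sub>R F 1 - deriv \<psi> 0 *\<^sub>R F 0) {0..1}"
      by (rule fundamental_theorem_of_calculus)
        (auto intro!: has_vector_derivative_scaleR dF has_field_derivative_at_within d)
    have i2: "((\<lambda>x. \<psi> x *\<^sub>R g x + deriv \<psi> x *\<^sub>R G x) has_integral \<psi> 1 *\<^sub>R G 1 - \<psi> 0 *\<^sub>R G 0) {0..1}"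
      by (rule has_integral_indefinite_parts(2)[OF bounded_bilinear_scaleR])
        (use vd d(3) ag in \<open>auto simp: G_def\<close>)
    have a2: "(\<lambda>x. \<psi> x *\<^sub>R g x) absolutely_integrable_on {0..1}"
      by (rule has_integral_indefinite_parts(1)[OF bounded_bilinear_scaleR, where G = G])
        (use vd d(3) ag in \<open>auto simp: G_def\<close>)
    have cc: "continuous_on {0..1} (\<lambda>x. deriv (deriv \<psi>) x *\<^sub>R F x)"
      by (intro continuous_intros d cF)
    have "(LINT x|I01. deriv (deriv \<psi>) x *\<^sub>R f x) = (LINT x|I01. deriv (deriv \<psi>) x *\<^sub>R F x)"
    proof (rule integral_cong_AE)
      show "(\<lambda>x. deriv (deriv \<psi>) x *\<^sub>R f x) \<in> borel_measurable I01"
        using f by (intro borel_measurable_scaleR[OF continuous_measurable_I01[OF d(4)]]) (simp add: L2_def)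
    qed (use FAE in \<open>auto intro!: continuous_measurable_I01 cc\<close>)
    also have "\<dots> = integral {0..1} (\<lambda>x. deriv (deriv \<psi>) x *\<^sub>R F x)"
      by (intro integral_I01 absolutely_integrable_continuous_real cc)
    finally have "integral {0..1} (\<lambda>x. deriv (deriv \<psi>) x *\<^sub>R F x) = integral {0..1} (\<lambda>x. \<psi> x *\<^sub>R g x)"
      using fg \<psi> integral_I01[OF a2] by (simp add: gen_deriv2_def eval_nat_numeral)
    moreover have "integral {0..1} (\<lambda>x. deriv \<psi> x *\<^sub>R F' x) + integral {0..1} (\<lambda>x. deriv (deriv \<psi>) x *\<^sub>R F x) = 0"
      using integral_unique[OF i1] b[of 0] b[of 1]
      by (subst (asm) integral_add) (auto intro!: integrable_continuous_real continuous_intros cF' d cc)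
    moreover have "integral {0..1} (\<lambda>x. \<psi> x *\<^sub>R g x) + integral {0..1} (\<lambda>x. deriv \<psi> x *\<^sub>R G x) = 0"
      using integral_unique[OF i2] b[of 0] b[of 1] set_lebesgue_integral_eq_integral(1)[OF a2]
      by (subst (asm) integral_add) (auto intro!: integrable_continuous_real continuous_intros cG d)
    moreover have "integral {0..1} (\<lambda>x. deriv \<psi> x *\<^sub>R (F' x - G x))
        = integral {0..1} (\<lambda>x. deriv \<psi> x *\<^sub>R F' x) - integral {0..1} (\<lambda>x. deriv \<psi> x *\<^sub>R G x)"
      unfolding scaleR_diff_right
      by (intro integral_diff integrable_continuous_real continuous_intros cF' cG d)
    ultimately show ?thesis by (simp add: add_eq_0_iff)
  qed
  have le: "(F' x - G x) \<bullet> e \<le> (F' y - G y) \<bullet> e" if "x \<in> {0<..<1}" "y \<in> {0<..<1}" for x y e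
  proof (rule du_Bois_Reymond[OF _ _ that])
    show "continuous_on {0..1} (\<lambda>x. (F' x - G x) \<bullet> e)"
      by (intro continuous_intros cF' cG)
    fix \<psi> assume \<psi>: "test_function \<psi>"
    have "integral {0..1} ((\<lambda>v. v \<bullet> e) \<circ> (\<lambda>x. deriv \<psi> x *\<^sub>R (F' x - G x)))
        = integral {0..1} (\<lambda>x. deriv \<psi> x *\<^sub>R (F' x - G x)) \<bullet> e"
      by (intro integral_linear bounded_linear_inner_left integrable_continuous_real continuous_intros
          cF' cG test_function_deriv[OF \<psi>])
    then show "integral {0..1} (\<lambda>x. deriv \<psi> x * ((F' x - G x) \<bullet> e)) = 0"
      using main[OF \<psi>] by (simp add: o_def)
  qed
  have half: "F' x - G x = F' (1/2) - G (1/2)" if "x \<in> {0<..<1}" for x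
  proof (rule euclidean_eqI)
    have h: "1/2 \<in> {0<..<1::real}" by simp
    fix e :: "complex ^ 2"
    show "(F' x - G x) \<bullet> e = (F' (1/2) - G (1/2)) \<bullet> e"
      by (rule antisym[OF le[OF that h] le[OF h that]])
  qed
  have const: "F' x - G x = F' (1/2) - G (1/2)" if "x \<in> {0..1}" for x
  proof (rule continuous_constant_on_closure[OF _ half])
    show "continuous_on (closure {0<..<1}) (\<lambda>x. F' x - G x)"
      using continuous_on_diff[OF cF' cG] by simp
    show "x \<in> closure {0<..<1}" using that by simp
  qed
  have "F' t - G t = F' 0 - G 0"
    by (rule trans[OF const[OF t] const[of 0, symmetric]]) simp
  then show ?thesis by (simp add: G_def algebra_simps)
qed

lemma bounded_bilinear_cinner2_mult: "bounded_bilinear (\<lambda>u v. cinner2 ((A :: complex ^ 2 ^ 2) *v v) u)"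
  unfolding bilinear_conv_bounded_bilinear[symmetric] bilinear_def
  by (auto intro!: linearI simp: cinner2_def sum_2 matrix_vector_mult_def algebra_simps
      scaleR_conv_of_real[where 'a = complex])

lemma numerical_value:
  assumes f: "f \<in> Dom_D" and F: "C1_rep f F F'"
    and bc: "F 0 $ 1 = 0" "F 1 $ 1 = 0" "F' 0 $ 2 = 0" "F' 1 $ 2 = 0"
  shows "L2_inner (op_AD A f) f = integral {0..1} (\<lambda>t. cinner2 (A *v F' t) (F' t))
    - A $ 2 $ 1 * (F' 1 $ 1 * cnj (F 1 $ 2) - F' 0 $ 1 * cnj (F 0 $ 2))"
proof -
  define g where "g = second_deriv f"
  have fL: "f \<in> L2" and "\<exists>g. g \<in> L2 \<and> gen_deriv2 f g"
    using f by (auto simp: Dom_D_def W22_def)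
  then have g: "g \<in> L2" "gen_deriv2 f g"
    unfolding g_def second_deriv_def using someI_ex by (metis (mono_tags, lifting))+
  have dF: "\<And>x. x \<in> {0..1} \<Longrightarrow> (F has_vector_derivative F' x) (at x within {0..1})"
    and cF': "continuous_on {0..1} F'" and FAE: "AE x in I01. F x = f x"
    using F by (auto simp: C1_rep_def)
  have cF: "continuous_on {0..1} F"
    by (rule continuous_on_vector_derivative[OF dF])
  have ag: "g absolutely_integrable_on {0..1}" by (rule L2_absolutely_integrable[OF g(1)])
  let ?h = "\<lambda>u v. cinner2 (A *v v) u"
  interpret h: bounded_bilinear ?h by (rule bounded_bilinear_cinner2_mult)
  note AC = W22_deriv_eq_integral[OF fL g F]
  note parts = has_integral_indefinite_parts[OF h.bounded_bilinear_axioms zero_le_one dF cF' ag AC]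
  have ai: "(\<lambda>x. ?h (F x) (g x)) absolutely_integrable_on {0..1}"
    by (rule parts(1)) auto
  have "((\<lambda>x. ?h (F x) (g x) + ?h (F' x) (F' x)) has_integral ?h (F 1) (F' 1) - ?h (F 0) (F' 0)) {0..1}"
    by (rule parts(2)) auto
  moreover have "(\<lambda>x. ?h (F' x) (F' x)) integrable_on {0..1}"
    by (intro integrable_continuous_real h.continuous_on cF')
  ultimately have parts': "integral {0..1} (\<lambda>x. ?h (F x) (g x)) + integral {0..1} (\<lambda>x. ?h (F' x) (F' x))
      = ?h (F 1) (F' 1) - ?h (F 0) (F' 0)"
    using set_lebesgue_integral_eq_integral(1)[OF ai]
    by (simp flip: integral_add add: integral_unique)
  have mh: "(\<lambda>x. ?h (w x) (g x)) \<in> borel_measurable I01" if "w \<in> borel_measurable I01" for w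
  proof -
    have "continuous_on UNIV (\<lambda>x. ?h (fst x) (snd x))"
      by (intro h.continuous_on continuous_on_fst continuous_on_snd continuous_on_id)
    moreover have "g \<in> borel_measurable I01" using g(1) by (simp add: L2_def)
    ultimately show ?thesis
      using borel_measurable_continuous_Pair[where H = "?h", OF that] by blast
  qed
  have "(\<lambda>x. cinner2 (op_AD A f x) (f x)) = (\<lambda>x. - ?h (f x) (g x))"
    by (simp add: op_AD_def op_D_def g_def cinner2_def sum_2 matrix_vector_mult_def algebra_simps)
  then have "L2_inner (op_AD A f) f = (LINT x|I01. - ?h (f x) (g x))"
    by (simp add: L2_inner_def)
  also have "\<dots> = - (LINT x|I01. ?h (f x) (g x))" by simp
  also have "(LINT x|I01. ?h (f x) (g x)) = (LINT x|I01. ?h (F x) (g x))"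
  proof (rule integral_cong_AE[OF mh mh])
    show "f \<in> borel_measurable I01" using fL by (simp add: L2_def)
    show "F \<in> borel_measurable I01" by (rule continuous_measurable_I01[OF cF])
    show "AE x in I01. ?h (f x) (g x) = ?h (F x) (g x)"
      using FAE by eventually_elim simp
  qed
  also have "\<dots> = integral {0..1} (\<lambda>x. ?h (F x) (g x))"
    by (rule integral_I01[OF ai])
  finally have "L2_inner (op_AD A f) f = integral {0..1} (\<lambda>x. ?h (F' x) (F' x)) - (?h (F 1) (F' 1) - ?h (F 0) (F' 0))"
    using parts' by (simp add: algebra_simps)
  then show ?thesis
    using bc by (simp add: cinner2_def sum_2 matrix_vector_mult_def algebra_simps)
qed

lemma C2_in_Dom_D:
  fixes F F' F'' :: "real \<Rightarrow> complex ^ 2"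
  assumes dF: "\<And>x. (F has_vector_derivative F' x) (at x)"
    and dF': "\<And>x. (F' has_vector_derivative F'' x) (at x)"
    and cF'': "continuous_on {0..1} F''"
    and bc: "F 0 $ 1 = 0" "F 1 $ 1 = 0" "F' 0 $ 2 = 0" "F' 1 $ 2 = 0"
  shows "F \<in> Dom_D" "C1_rep F F F'"
proof -
  have cF: "continuous_on {0..1} F" and cF': "continuous_on {0..1} F'"
    by (rule continuous_on_vector_derivative, rule has_vector_derivative_at_within, rule dF dF')+
  show rep: "C1_rep F F F'"
    unfolding C1_rep_def using dF cF' by (auto intro: has_vector_derivative_at_within)
  have "gen_deriv2 F F''"
    unfolding gen_deriv2_def
  proof (intro allI impI)
    fix \<psi> assume \<psi>: "test_function \<psi>"
    note d = test_function_deriv[OF \<psi>]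
    note b = test_function_boundary[OF \<psi>]
    have c\<psi>: "continuous_on {0..1} \<psi>"
      by (rule DERIV_continuous_on[OF has_field_derivative_at_within[OF d(1)]])
    have i1: "((\<lambda>x. deriv \<psi> x *\<^sub>R F' x + deriv (deriv \<psi>) x *\<^sub>R F x - (\<psi> x *\<^sub>R F'' x + deriv \<psi> x *\<^sub>R F' x)) has_integral
        (deriv \<psi> 1 *\<^sub>R F 1 - \<psi> 1 *\<^sub>R F' 1) - (deriv \<psi> 0 *\<^sub>R F 0 - \<psi> 0 *\<^sub>R F' 0)) {0..1}"
      by (rule fundamental_theorem_of_calculus)
        (simp, rule has_vector_derivative_diff[OF
          has_vector_derivative_scaleR[OF has_field_derivative_at_within[OF d(2)] has_vector_derivative_at_within[OF dF]]
          has_vector_derivative_scaleR[OF has_field_derivative_at_within[OF d(1)] has_vector_derivative_at_within[OF dF']]])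
    have c1: "continuous_on {0..1} (\<lambda>x. deriv (deriv \<psi>) x *\<^sub>R F x)"
      and c2: "continuous_on {0..1} (\<lambda>x. \<psi> x *\<^sub>R F'' x)"
      by (intro continuous_intros d cF c\<psi> cF'')+
    have "((\<lambda>x. deriv (deriv \<psi>) x *\<^sub>R F x - \<psi> x *\<^sub>R F'' x) has_integral 0) {0..1}"
      using i1 b[of 0] b[of 1] by (simp add: algebra_simps)
    then have "integral {0..1} (\<lambda>x. deriv (deriv \<psi>) x *\<^sub>R F x) = integral {0..1} (\<lambda>x. \<psi> x *\<^sub>R F'' x)"
      using integral_diff[OF integrable_continuous_real[OF c1] integrable_continuous_real[OF c2]]
      by (simp add: integral_unique)
    then show "(LINT x|I01. (deriv ^^ 2) \<psi> x *\<^sub>R F x) = (LINT x|I01. \<psi> x *\<^sub>R F'' x)"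
      using c1 c2 by (simp add: integral_I01 absolutely_integrable_continuous_real eval_nat_numeral)
  qed
  then have "F \<in> W22"
    using continuous_L2[OF cF] continuous_L2[OF cF''] by (auto simp: W22_def)
  then show "F \<in> Dom_D"
    using rep bc by (auto simp: Dom_D_def)
qed

section \<open>The numerical range of AD\<close>

lemma Num_AD_subset_rays:
  assumes A: "A $ 2 $ 1 = 0"
  shows "Num_AD A \<subseteq> rays (Num_matrix A)"
proof
  fix z assume "z \<in> Num_AD A"
  then obtain f where f: "f \<in> Dom_D" and z: "z = L2_inner (op_AD A f) f"
    by (auto simp: Num_AD_def numerical_range_def)
  then obtain F F' where rep: "C1_rep f F F'"
    and bc: "F 0 $ 1 = 0" "F 1 $ 1 = 0" "F' 0 $ 2 = 0" "F' 1 $ 2 = 0"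
    by (auto simp: Dom_D_def)
  have cF': "continuous_on {0..1} F'" using rep by (simp add: C1_rep_def)
  define u v where "u t = F' t $ 1" and "v t = F' t $ 2" for t
  have c: "continuous_on {0..1} u" "continuous_on {0..1} v"
    unfolding u_def v_def by (intro continuous_intros cF')+
  define P Q W where "P = integral {0..1} (\<lambda>t. (norm (u t))\<^sup>2)"
    and "Q = integral {0..1} (\<lambda>t. (norm (v t))\<^sup>2)" and "W = integral {0..1} (\<lambda>t. v t * cnj (u t))"
  have iP: "((\<lambda>t. (norm (u t))\<^sup>2) has_integral P) {0..1}"
    and iQ: "((\<lambda>t. (norm (v t))\<^sup>2) has_integral Q) {0..1}"
    and iW: "((\<lambda>t. v t * cnj (u t)) has_integral W) {0..1}"
    unfolding P_def Q_def W_def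
    by (intro integrable_integral integrable_continuous_real continuous_intros c)+
  have "((\<lambda>t. A $ 1 $ 1 * of_real ((norm (u t))\<^sup>2) + A $ 2 $ 2 * of_real ((norm (v t))\<^sup>2)
      + A $ 1 $ 2 * (v t * cnj (u t))) has_integral
      A $ 1 $ 1 * of_real P + A $ 2 $ 2 * of_real Q + A $ 1 $ 2 * W) {0..1}"
    by (intro has_integral_add has_integral_mult_right has_integral_of_real iP iQ iW)
  also have "(\<lambda>t. A $ 1 $ 1 * of_real ((norm (u t))\<^sup>2) + A $ 2 $ 2 * of_real ((norm (v t))\<^sup>2)
      + A $ 1 $ 2 * (v t * cnj (u t))) = (\<lambda>t. cinner2 (A *v F' t) (F' t))"
    using A by (simp add: cinner2_mult u_def v_def complex_norm_square algebra_simps del: of_real_power)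
  finally have z_eq: "z = A $ 1 $ 1 * of_real P + A $ 2 $ 2 * of_real Q + A $ 1 $ 2 * W"
    using numerical_value[OF f rep bc, of A] A z by (simp add: integral_unique)
  have form: "P * (norm s)\<^sup>2 + Q * (norm t)\<^sup>2 + 2 * Re (s * t * W) \<ge> 0" for s t :: complex
  proof -
    have "((\<lambda>x. (norm (u x))\<^sup>2 * (norm s)\<^sup>2 + (norm (v x))\<^sup>2 * (norm t)\<^sup>2
        + 2 * Re (s * t * (v x * cnj (u x)))) has_integral
        P * (norm s)\<^sup>2 + Q * (norm t)\<^sup>2 + 2 * Re (s * t * W)) {0..1}"
      by (intro has_integral_add has_integral_mult_right has_integral_mult_left has_integral_Re iP iQ iW)
    moreover have "(norm (u x))\<^sup>2 * (norm s)\<^sup>2 + (norm (v x))\<^sup>2 * (norm t)\<^sup>2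
        + 2 * Re (s * t * (v x * cnj (u x))) = (norm (cnj s * u x + t * v x))\<^sup>2" for x
      unfolding cmod_power2 by (simp add: power2_eq_square algebra_simps)
    ultimately have "((\<lambda>x. (norm (cnj s * u x + t * v x))\<^sup>2) has_integral
        P * (norm s)\<^sup>2 + Q * (norm t)\<^sup>2 + 2 * Re (s * t * W)) {0..1}"
      by simp
    then show ?thesis by (rule has_integral_nonneg) simp
  qed
  obtain p q w where "p \<ge> 0" "q \<ge> 0" "(norm w)\<^sup>2 = p * q"
    "A $ 1 $ 1 * of_real p + A $ 2 $ 2 * of_real q + A $ 1 $ 2 * w
      = A $ 1 $ 1 * of_real P + A $ 2 $ 2 * of_real Q + A $ 1 $ 2 * W"
    by (rule rank_one_same_value[OF norm_le_of_nonneg_form[OF form]])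
  then show "z \<in> rays (Num_matrix A)"
    using mem_rays_Num_matrix[of p q w A] A z_eq by simp
qed

lemma bounded_linear_vector_2:
  "bounded_linear (\<lambda>x::complex. vector [x, 0] :: complex ^ 2)"
  "bounded_linear (\<lambda>x::complex. vector [0, x] :: complex ^ 2)"
  by (auto simp: linear_conv_bounded_linear[symmetric] vec_eq_iff forall_2 intro!: linearI)

lemma vector_2_split: "(vector [x, y] :: complex ^ 2) = vector [x, 0] + vector [0, y]"
  by (simp add: vec_eq_iff forall_2)

lemma has_vector_derivative_vector_2:
  assumes "(f has_vector_derivative f') (at x)" "(g has_vector_derivative g') (at x)"
  shows "((\<lambda>t. vector [f t, g t] :: complex ^ 2) has_vector_derivative vector [f', g']) (at x)"
  using has_vector_derivative_add[OF
      bounded_linear.has_vector_derivative[OF bounded_linear_vector_2(1) assms(1)]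
      bounded_linear.has_vector_derivative[OF bounded_linear_vector_2(2) assms(2)]]
  unfolding vector_2_split[symmetric] .

lemma continuous_on_vector_2:
  assumes "continuous_on S f" "continuous_on S g"
  shows "continuous_on S (\<lambda>t. vector [f t, g t] :: complex ^ 2)"
  using continuous_on_add[OF bounded_linear.continuous_on[OF bounded_linear_vector_2(1) assms(1)]
      bounded_linear.continuous_on[OF bounded_linear_vector_2(2) assms(2)]]
  unfolding vector_2_split[symmetric] .

lemma cinner2_mult_scaleR:
  fixes A :: "complex ^ 2 ^ 2"
  shows "cinner2 (A *v (s *\<^sub>R v)) (s *\<^sub>R w) = of_real (s\<^sup>2) * cinner2 (A *v v) w"
  by (simp add: cinner2_def sum_2 matrix_vector_mult_def scaleR_conv_of_real[where 'a = complex]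
      power2_eq_square algebra_simps)

lemma cinner2_scaleR: "cinner2 (s *\<^sub>R v) (s *\<^sub>R w) = of_real (s\<^sup>2) * cinner2 v w"
  by (simp add: cinner2_def sum_2 scaleR_conv_of_real[where 'a = complex] power2_eq_square algebra_simps)

lemma Num_AD_memI:
  fixes \<phi> \<phi>' \<phi>'' \<gamma> \<gamma>' \<gamma>'' :: "real \<Rightarrow> complex"
  assumes d\<phi>: "\<And>x. (\<phi> has_vector_derivative \<phi>' x) (at x)" "\<And>x. (\<phi>' has_vector_derivative \<phi>'' x) (at x)"
    and d\<gamma>: "\<And>x. (\<gamma> has_vector_derivative \<gamma>' x) (at x)" "\<And>x. (\<gamma>' has_vector_derivative \<gamma>'' x) (at x)"
    and c: "continuous_on {0..1} \<phi>''" "continuous_on {0..1} \<gamma>''"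
    and bc: "\<phi> 0 = 0" "\<phi> 1 = 0" "\<gamma>' 0 = 0" "\<gamma>' 1 = 0"
    and N: "((\<lambda>t. (norm (\<phi> t))\<^sup>2 + (norm (\<gamma> t))\<^sup>2) has_integral N) {0..1}" "N > 0"
    and V: "((\<lambda>t. A $ 1 $ 1 * (\<phi>' t * cnj (\<phi>' t)) + A $ 1 $ 2 * (\<gamma>' t * cnj (\<phi>' t))
        + A $ 2 $ 1 * (\<phi>' t * cnj (\<gamma>' t)) + A $ 2 $ 2 * (\<gamma>' t * cnj (\<gamma>' t))) has_integral V) {0..1}"
    and z: "z * of_real N = V - A $ 2 $ 1 * (\<phi>' 1 * cnj (\<gamma> 1) - \<phi>' 0 * cnj (\<gamma> 0))"
  shows "z \<in> Num_AD A"
proof -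
  define s where "s = 1 / sqrt N"
  have s: "s\<^sup>2 * N = 1" using N by (simp add: s_def power_divide)
  define F F' F'' :: "real \<Rightarrow> complex ^ 2" where "F t = vector [\<phi> t, \<gamma> t]"
    and "F' t = vector [\<phi>' t, \<gamma>' t]" and "F'' t = vector [\<phi>'' t, \<gamma>'' t]" for t
  let ?f = "\<lambda>t. s *\<^sub>R F t" and ?f' = "\<lambda>t. s *\<^sub>R F' t" and ?f'' = "\<lambda>t. s *\<^sub>R F'' t"
  have d: "(?f has_vector_derivative ?f' x) (at x)" "(?f' has_vector_derivative ?f'' x) (at x)" for x
    unfolding F_def F'_def F''_def
    by (intro bounded_linear.has_vector_derivative[OF bounded_linear_scaleR_right]
        has_vector_derivative_vector_2 d\<phi> d\<gamma>)+
  have c'': "continuous_on {0..1} ?f''"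
    unfolding F''_def by (intro continuous_intros continuous_on_vector_2 c)
  have bc': "?f 0 $ 1 = 0" "?f 1 $ 1 = 0" "?f' 0 $ 2 = 0" "?f' 1 $ 2 = 0"
    using bc by (simp_all add: F_def F'_def)
  note dom = C2_in_Dom_D[OF d c'' bc']
  have "((\<lambda>t. of_real (s\<^sup>2) * (A $ 1 $ 1 * (\<phi>' t * cnj (\<phi>' t)) + A $ 1 $ 2 * (\<gamma>' t * cnj (\<phi>' t))
        + A $ 2 $ 1 * (\<phi>' t * cnj (\<gamma>' t)) + A $ 2 $ 2 * (\<gamma>' t * cnj (\<gamma>' t)))) has_integral of_real (s\<^sup>2) * V) {0..1}"
    by (intro has_integral_mult_right V)
  also have "(\<lambda>t. of_real (s\<^sup>2) * (A $ 1 $ 1 * (\<phi>' t * cnj (\<phi>' t)) + A $ 1 $ 2 * (\<gamma>' t * cnj (\<phi>' t))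
        + A $ 2 $ 1 * (\<phi>' t * cnj (\<gamma>' t)) + A $ 2 $ 2 * (\<gamma>' t * cnj (\<gamma>' t))))
      = (\<lambda>t. cinner2 (A *v ?f' t) (?f' t))"
    unfolding cinner2_mult_scaleR unfolding cinner2_mult by (simp add: F'_def)
  finally have "L2_inner (op_AD A ?f) ?f = of_real (s\<^sup>2) * V
      - A $ 2 $ 1 * (?f' 1 $ 1 * cnj (?f 1 $ 2) - ?f' 0 $ 1 * cnj (?f 0 $ 2))"
    using numerical_value[OF dom bc', of A] by (simp only: integral_unique)
  also have "\<dots> = of_real (s\<^sup>2) * (V - A $ 2 $ 1 * (\<phi>' 1 * cnj (\<gamma> 1) - \<phi>' 0 * cnj (\<gamma> 0)))"
    by (simp add: F_def F'_def scaleR_conv_of_real[where 'a = complex] power2_eq_square algebra_simps)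
  also have "\<dots> = z * of_real (s\<^sup>2 * N)"
    unfolding z[symmetric] by (simp add: mult_ac)
  finally have val: "L2_inner (op_AD A ?f) ?f = z" using s by simp
  have self: "cinner2 (?f t) (?f t) = of_real (s\<^sup>2 * ((norm (\<phi> t))\<^sup>2 + (norm (\<gamma> t))\<^sup>2))" for t
    unfolding cinner2_scaleR unfolding cinner2_self by (simp add: F_def)
  have "continuous_on {0..1} F"
    unfolding F_def by (rule continuous_on_vector_derivative[OF has_vector_derivative_at_within[OF
      has_vector_derivative_vector_2[OF d\<phi>(1) d\<gamma>(1)]]])
  then have "L2_inner ?f ?f = integral {0..1} (\<lambda>t. cinner2 (?f t) (?f t))"
    unfolding L2_inner_def cinner2_def
    by (intro integral_I01 absolutely_integrable_continuous_real continuous_intros)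
  also have "\<dots> = of_real (s\<^sup>2 * N)"
    unfolding self by (intro integral_unique has_integral_of_real has_integral_mult_right N)
  finally have "sqrt (Re (L2_inner ?f ?f)) = 1" using s by simp
  then show ?thesis
    unfolding Num_AD_def numerical_range_def using dom(1) val by blast
qed

lemma has_vector_derivative_mult_of_real:
  assumes "(f has_real_derivative f') (at x)"
  shows "((\<lambda>t. c * complex_of_real (f t)) has_vector_derivative c * of_real f') (at x)"
  using bounded_linear.has_vector_derivative[of "\<lambda>t. c * complex_of_real t" f f' "at x"] assms
  by (simp add: has_real_derivative_iff_has_vector_derivative bounded_linear_mult_const
      bounded_linear_const_mult bounded_linear_of_real)

lemma rays_subset_Num_AD:
  assumes A: "A $ 2 $ 1 = 0"
  shows "rays (Num_matrix A) \<subseteq> Num_AD A"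
proof
  fix z assume "z \<in> rays (Num_matrix A)"
  then obtain r v where r: "r \<ge> 0" and z: "z = of_real r * cinner2 (A *v v) v"
    and v: "sqrt (Re (cinner2 v v)) = 1"
    by (auto simp: rays_def Num_matrix_def numerical_range_def)
  define x y where "x = v $ 1" and "y = v $ 2"
  have xy: "(norm x)\<^sup>2 + (norm y)\<^sup>2 = 1" using v by (simp add: cinner2_self x_def y_def)
  show "z \<in> Num_AD A"
  proof (cases "r = 0")
    case True
    have "((\<lambda>t::real. (norm (0 :: complex))\<^sup>2 + (norm (1 :: complex))\<^sup>2) has_integral 1) {0..1}"
      using has_integral_const_real[of "1 :: real" 0 1] by simp
    then show ?thesis
      by (rule Num_AD_memI[of "\<lambda>_. 0" "\<lambda>_. 0" "\<lambda>_. 0" "\<lambda>_. 1" "\<lambda>_. 0" "\<lambda>_. 0", where N = 1 and V = 0, rotated -4])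
        (use True z in \<open>auto intro!: derivative_eq_intros\<close>)
  next
    case False
    then have "r > 0" using r by simp
    obtain n where n: "real n \<ge> 3 * r + 1" using real_arch_simple by blast
    define w where "w = 2 * pi * real n"
    have "n > 0" using n \<open>r > 0\<close> by (cases n) auto
    have "real n \<le> w" using pi_gt3 by (simp add: w_def mult_le_cancel_right1)
    then have "1 \<le> w" "3 * r \<le> w" using n \<open>r > 0\<close> by linarith+
    then have w2: "3 * r \<le> w\<^sup>2"
      unfolding power2_eq_square using mult_mono[of 1 w "3 * r" w] \<open>r > 0\<close> by simp
    define K where "K = w\<^sup>2 / (2 * r) - 3 / 2 * (norm x)\<^sup>2 - (norm y)\<^sup>2 / 2"
    have "w\<^sup>2 / (2 * r) \<ge> 3 / 2" using w2 \<open>r > 0\<close> by (simp add: field_simps)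
    then have "K \<ge> 0" using xy zero_le_power2[of "norm y"] unfolding K_def by linarith
    define k where "k = sqrt K"
    have k: "k\<^sup>2 = K" using \<open>K \<ge> 0\<close> by (simp add: k_def)
    note trig = trig_period_integrals[OF \<open>n > 0\<close> w_def]
    have sin_w: "sin w = 0" "cos w = 1"
      using sin_npi2[of "2 * n"] cos_2npi[of n] by (simp_all add: w_def mult_ac)
    show ?thesis
    proof (rule Num_AD_memI)
      show "((\<lambda>t. x * of_real (1 - cos (w * t))) has_vector_derivative x * of_real (w * sin (w * t))) (at t)" for t
        by (intro has_vector_derivative_mult_of_real) (auto intro!: derivative_eq_intros)
      show "((\<lambda>t. x * of_real (w * sin (w * t))) has_vector_derivative x * of_real (w\<^sup>2 * cos (w * t))) (at t)" for t
        by (intro has_vector_derivative_mult_of_real) (auto intro!: derivative_eq_intros simp: power2_eq_square)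
      have "((\<lambda>t. of_real k + y * of_real (- cos (w * t))) has_vector_derivative 0 + y * of_real (w * sin (w * t))) (at t)" for t
        by (intro has_vector_derivative_add has_vector_derivative_const has_vector_derivative_mult_of_real)
          (auto intro!: derivative_eq_intros)
      then show "((\<lambda>t. of_real k + y * of_real (- cos (w * t))) has_vector_derivative y * of_real (w * sin (w * t))) (at t)" for t
        by simp
      show "((\<lambda>t. y * of_real (w * sin (w * t))) has_vector_derivative y * of_real (w\<^sup>2 * cos (w * t))) (at t)" for t
        by (intro has_vector_derivative_mult_of_real) (auto intro!: derivative_eq_intros simp: power2_eq_square)
      have "((\<lambda>t. ((norm x)\<^sup>2 + k\<^sup>2) + (- 2 * (norm x)\<^sup>2 - 2 * k * Re y) * cos (w * t)
          + ((norm x)\<^sup>2 + (norm y)\<^sup>2) * (cos (w * t))\<^sup>2) has_integral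
          ((norm x)\<^sup>2 + k\<^sup>2) + (- 2 * (norm x)\<^sup>2 - 2 * k * Re y) * 0 + ((norm x)\<^sup>2 + (norm y)\<^sup>2) * (1 / 2)) {0..1}"
        using has_integral_const_real[of "(norm x)\<^sup>2 + k\<^sup>2" 0 1]
        by (intro has_integral_add[OF has_integral_add] has_integral_mult_right trig) simp
      moreover have "((norm x)\<^sup>2 + k\<^sup>2) + (- 2 * (norm x)\<^sup>2 - 2 * k * Re y) * 0 + ((norm x)\<^sup>2 + (norm y)\<^sup>2) * (1 / 2)
          = w\<^sup>2 / (2 * r)"
        by (simp add: k K_def field_simps)
      moreover have "((norm x)\<^sup>2 + k\<^sup>2) + (- 2 * (norm x)\<^sup>2 - 2 * k * Re y) * cos (w * t)
          + ((norm x)\<^sup>2 + (norm y)\<^sup>2) * (cos (w * t))\<^sup>2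
          = (norm (x * of_real (1 - cos (w * t))))\<^sup>2 + (norm (of_real k + y * of_real (- cos (w * t))))\<^sup>2" for t
        unfolding cmod_power2 by (simp add: power2_eq_square algebra_simps)
      ultimately show "((\<lambda>t. (norm (x * of_real (1 - cos (w * t))))\<^sup>2
          + (norm (of_real k + y * of_real (- cos (w * t))))\<^sup>2) has_integral w\<^sup>2 / (2 * r)) {0..1}"
        by simp
      show "w\<^sup>2 / (2 * r) > 0" using \<open>1 \<le> w\<close> \<open>r > 0\<close> by simp
      have "((\<lambda>t. of_real ((sin (w * t))\<^sup>2) * (of_real (w\<^sup>2) * cinner2 (A *v v) v)) has_integral
          of_real (1 / 2) * (of_real (w\<^sup>2) * cinner2 (A *v v) v)) {0..1}"
        by (intro has_integral_mult_left has_integral_of_real trig)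
      also have "(\<lambda>t. of_real ((sin (w * t))\<^sup>2) * (of_real (w\<^sup>2) * cinner2 (A *v v) v)) =
        (\<lambda>t. A $ 1 $ 1 * (x * of_real (w * sin (w * t)) * cnj (x * of_real (w * sin (w * t))))
          + A $ 1 $ 2 * (y * of_real (w * sin (w * t)) * cnj (x * of_real (w * sin (w * t))))
          + A $ 2 $ 1 * (x * of_real (w * sin (w * t)) * cnj (y * of_real (w * sin (w * t))))
          + A $ 2 $ 2 * (y * of_real (w * sin (w * t)) * cnj (y * of_real (w * sin (w * t)))))"
        by (simp add: fun_eq_iff cinner2_mult x_def y_def power2_eq_square algebra_simps)
      finally show "((\<lambda>t. A $ 1 $ 1 * (x * of_real (w * sin (w * t)) * cnj (x * of_real (w * sin (w * t))))
          + A $ 1 $ 2 * (y * of_real (w * sin (w * t)) * cnj (x * of_real (w * sin (w * t))))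
          + A $ 2 $ 1 * (x * of_real (w * sin (w * t)) * cnj (y * of_real (w * sin (w * t))))
          + A $ 2 $ 2 * (y * of_real (w * sin (w * t)) * cnj (y * of_real (w * sin (w * t))))) has_integral
          of_real (1 / 2) * (of_real (w\<^sup>2) * cinner2 (A *v v) v)) {0..1}" .
    qed (use A z \<open>r > 0\<close> sin_w in \<open>auto intro!: continuous_intros\<close>)
  qed
qed

lemma Num_AD_eq_UNIV:
  assumes A: "A $ 2 $ 1 \<noteq> 0"
  shows "Num_AD A = UNIV"
proof -
  have "z \<in> Num_AD A" for z
  proof -
    obtain e where e: "e > 0"
      "\<And>\<eta>. norm \<eta> \<le> e \<Longrightarrow> \<exists>\<delta>. \<eta> * of_real ((norm \<delta>)\<^sup>2) - A $ 2 $ 1 * \<delta> = z"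
      using small_quadratic_fixed_point[OF A] by metis
    define E where "E m = (real m + 3)\<^sup>2 / (2 * real m + 5) - (real m + 3) + (real m + 2)\<^sup>2 / (2 * real m + 3)" for m
    define M where "M m = 1 / (2 * real m + 7) - 1 / (real m + 3) + 1 / (2 * real m + 5)" for m
    have "E \<longlonglongrightarrow> 0" unfolding E_def by real_asymp
    moreover have "M \<longlonglongrightarrow> 0" unfolding M_def by real_asymp
    ultimately have "(\<lambda>m. A $ 1 $ 1 * of_real (E m) - z * of_real (M m)) \<longlonglongrightarrow> A $ 1 $ 1 * of_real 0 - z * of_real 0"
      by (intro tendsto_intros)
    then have "\<forall>\<^sub>F m in sequentially. norm (A $ 1 $ 1 * of_real (E m) - z * of_real (M m)) < e"
      using e(1) tendstoD by (fastforce simp: dist_norm)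
    then obtain m where "norm (A $ 1 $ 1 * of_real (E m) - z * of_real (M m)) \<le> e"
      by (meson eventually_happens' sequentially_bot less_imp_le)
    then obtain \<delta> where \<delta>: "(A $ 1 $ 1 * of_real (E m) - z * of_real (M m)) * of_real ((norm \<delta>)\<^sup>2) - A $ 2 $ 1 * \<delta> = z"
      using e(2) by blast
    have pw: "((\<lambda>t::real. t ^ k) has_integral 1 / (real k + 1)) {0..1}" for k
    proof -
      have "((\<lambda>t. t ^ Suc k / real (Suc k)) has_real_derivative t ^ k) (at t within {0..1})" for t
        using DERIV_cdivide[OF DERIV_pow[of "Suc k" t "{0..1}"], of "real (Suc k)"]
        by (simp del: of_nat_Suc power_Suc)
      then have "((\<lambda>t::real. t ^ k) has_integral 1 ^ Suc k / real (Suc k) - 0 ^ Suc k / real (Suc k)) {0..1}"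
        by (intro fundamental_theorem_of_calculus) (simp_all only: has_real_derivative_iff_has_vector_derivative zero_le_one)
      then show ?thesis by (simp add: add.commute)
    qed
    define p p' p'' where "p t = t ^ (m + 3) - t ^ (m + 2)"
      and "p' t = (real m + 3) * t ^ (m + 2) - (real m + 2) * t ^ (m + 1)"
      and "p'' t = (real m + 3) * (real m + 2) * t ^ (m + 1) - (real m + 2) * (real m + 1) * t ^ m" for t :: real
    have dp: "(p has_real_derivative p' t) (at t)" for t
      using DERIV_diff[OF DERIV_pow[of "m + 3" t] DERIV_pow[of "m + 2" t]]
      by (simp add: p_def[abs_def] p'_def numeral_eq_Suc algebra_simps)
    have dp': "(p' has_real_derivative p'' t) (at t)" for t
      using DERIV_diff[OF DERIV_cmult[OF DERIV_pow[of "m + 2" t], of "real m + 3"]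
          DERIV_cmult[OF DERIV_pow[of "m + 1" t], of "real m + 2"]]
      by (simp add: p'_def[abs_def] p''_def numeral_eq_Suc algebra_simps)
    have square: "(a * X - b * Y)\<^sup>2 = a\<^sup>2 * (X * X) - 2 * a * b * (X * Y) + b\<^sup>2 * (Y * Y)"
      for a b X Y :: real
      by (simp add: power2_eq_square algebra_simps)
    have exps: "t ^ i * t ^ j = t ^ k" if "i + j = k" for t :: real and i j k
      using that power_add[of t i j] by simp
    have iM: "((\<lambda>t. (p t)\<^sup>2) has_integral M m) {0..1}"
    proof -
      have "((\<lambda>t. t ^ (2 * m + 6) - 2 * t ^ (2 * m + 5) + t ^ (2 * m + 4)) has_integral
          1 / (real (2 * m + 6) + 1) - 2 * (1 / (real (2 * m + 5) + 1)) + 1 / (real (2 * m + 4) + 1)) {0..1}"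
        by (intro has_integral_add has_integral_diff has_integral_mult_right pw)
      moreover have "2 * (1 / (real (2 * m + 5) + 1)) = 1 / (real m + 3)"
        by (simp add: field_simps)
      moreover have "t ^ (2 * m + 6) - 2 * t ^ (2 * m + 5) + t ^ (2 * m + 4) = (p t)\<^sup>2" for t
        using square[of 1 "t ^ (m + 3)" 1 "t ^ (m + 2)"]
          exps[of "m + 3" "m + 3" "2 * m + 6" t] exps[of "m + 3" "m + 2" "2 * m + 5" t]
          exps[of "m + 2" "m + 2" "2 * m + 4" t]
        by (simp only: p_def) simp
      ultimately show ?thesis by (simp add: M_def add.commute)
    qed
    have iE: "((\<lambda>t. (p' t)\<^sup>2) has_integral E m) {0..1}"
    proof -
      have "((\<lambda>t. (real m + 3)\<^sup>2 * t ^ (2 * m + 4) - 2 * (real m + 3) * (real m + 2) * t ^ (2 * m + 3)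
          + (real m + 2)\<^sup>2 * t ^ (2 * m + 2)) has_integral
          (real m + 3)\<^sup>2 * (1 / (real (2 * m + 4) + 1)) - 2 * (real m + 3) * (real m + 2) * (1 / (real (2 * m + 3) + 1))
          + (real m + 2)\<^sup>2 * (1 / (real (2 * m + 2) + 1))) {0..1}"
        by (intro has_integral_add has_integral_diff has_integral_mult_right pw)
      moreover have "2 * (real m + 3) * (real m + 2) * (1 / (real (2 * m + 3) + 1)) = real m + 3"
        by (simp add: field_simps)
      moreover have "(real m + 3)\<^sup>2 * t ^ (2 * m + 4) - 2 * (real m + 3) * (real m + 2) * t ^ (2 * m + 3)
          + (real m + 2)\<^sup>2 * t ^ (2 * m + 2) = (p' t)\<^sup>2" for t
        using square[of "real m + 3" "t ^ (m + 2)" "real m + 2" "t ^ (m + 1)"]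
          exps[of "m + 2" "m + 2" "2 * m + 4" t] exps[of "m + 2" "m + 1" "2 * m + 3" t]
          exps[of "m + 1" "m + 1" "2 * m + 2" t]
        by (simp only: p'_def)
      ultimately show ?thesis by (simp add: E_def add.commute)
    qed
    have "M m \<ge> 0" using has_integral_nonneg[OF iM] by simp
    have pos: "(norm \<delta>)\<^sup>2 * M m + 1 > 0"
      using mult_nonneg_nonneg[OF zero_le_power2[of "norm \<delta>"] \<open>M m \<ge> 0\<close>] by linarith
    show ?thesis
    proof (rule Num_AD_memI)
      show "((\<lambda>t. \<delta> * of_real (p t)) has_vector_derivative \<delta> * of_real (p' t)) (at t)"
        "((\<lambda>t. \<delta> * of_real (p' t)) has_vector_derivative \<delta> * of_real (p'' t)) (at t)" for t
        by (intro has_vector_derivative_mult_of_real dp dp')+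
      show "((\<lambda>t. 1) has_vector_derivative (\<lambda>_. 0) t) (at t)" "((\<lambda>_. 0) has_vector_derivative (\<lambda>_. 0) t) (at t)" for t :: real
        by simp_all
      have "((\<lambda>t. (norm \<delta>)\<^sup>2 * (p t)\<^sup>2 + 1) has_integral (norm \<delta>)\<^sup>2 * M m + 1) {0..1}"
        using has_integral_const_real[of "1::real" 0 1]
        by (intro has_integral_add has_integral_mult_right iM) simp
      then show "((\<lambda>t. (norm (\<delta> * of_real (p t)))\<^sup>2 + (norm (1 :: complex))\<^sup>2) has_integral (norm \<delta>)\<^sup>2 * M m + 1) {0..1}"
        by (simp add: norm_mult power_mult_distrib)
      have "((\<lambda>t. A $ 1 $ 1 * of_real ((norm \<delta>)\<^sup>2) * of_real ((p' t)\<^sup>2)) has_integral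
          A $ 1 $ 1 * of_real ((norm \<delta>)\<^sup>2) * of_real (E m)) {0..1}"
        by (intro has_integral_mult_right has_integral_of_real iE)
      also have "(\<lambda>t. A $ 1 $ 1 * of_real ((norm \<delta>)\<^sup>2) * of_real ((p' t)\<^sup>2))
          = (\<lambda>t. A $ 1 $ 1 * (\<delta> * of_real (p' t) * cnj (\<delta> * of_real (p' t))) + A $ 1 $ 2 * (0 * cnj (\<delta> * of_real (p' t)))
          + A $ 2 $ 1 * (\<delta> * of_real (p' t) * cnj 0) + A $ 2 $ 2 * (0 * cnj 0))"
        unfolding complex_norm_square by (simp add: power2_eq_square mult_ac)
      finally show "((\<lambda>t. A $ 1 $ 1 * (\<delta> * of_real (p' t) * cnj (\<delta> * of_real (p' t))) + A $ 1 $ 2 * (0 * cnj (\<delta> * of_real (p' t)))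
          + A $ 2 $ 1 * (\<delta> * of_real (p' t) * cnj 0) + A $ 2 $ 2 * (0 * cnj 0)) has_integral
          A $ 1 $ 1 * of_real ((norm \<delta>)\<^sup>2) * of_real (E m)) {0..1}" .
      have "p' 1 = 1" "p' 0 = 0" by (simp_all add: p'_def)
      then show "z * of_real ((norm \<delta>)\<^sup>2 * M m + 1) = A $ 1 $ 1 * of_real ((norm \<delta>)\<^sup>2) * of_real (E m)
          - A $ 2 $ 1 * (\<delta> * of_real (p' 1) * cnj 1 - \<delta> * of_real (p' 0) * cnj 1)"
        using \<delta> by (simp add: algebra_simps)
      show "continuous_on {0..1} (\<lambda>t. \<delta> * of_real (p'' t))"
        unfolding p''_def by (intro continuous_intros)
      show "\<delta> * of_real (p 0) = 0" "\<delta> * of_real (p 1) = 0"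
        by (simp_all add: p_def)
    qed (use pos in simp_all)
  qed
  then show ?thesis by blast
qed

lemma closure_rays_closure: "closure (rays (closure S)) = closure (rays S)"
proof (rule antisym)
  show "closure (rays S) \<subseteq> closure (rays (closure S))"
    unfolding rays_def using closure_subset[of S] by (intro closure_mono) blast
  have "rays (closure S) \<subseteq> closure (rays S)"
  proof
    fix z assume "z \<in> rays (closure S)"
    then obtain r s where rs: "r \<ge> 0" "s \<in> closure S" "z = of_real r * s"
      by (auto simp: rays_def)
    then obtain X where X: "\<And>n. X n \<in> S" "X \<longlonglongrightarrow> s"
      unfolding closure_sequential by blast
    have "(\<lambda>n. of_real r * X n) \<longlonglongrightarrow> z"
      unfolding rs(3) by (intro tendsto_intros X)
    moreover have "of_real r * X n \<in> rays S" for n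
      using X rs by (auto simp: rays_def)
    ultimately show "z \<in> closure (rays S)"
      unfolding closure_sequential by (intro exI conjI allI)
  qed
  then show "closure (rays (closure S)) \<subseteq> closure (rays S)"
    by (simp add: closure_minimal)
qed

theorem theorem4:
  fixes A :: "complex ^ 2 ^ 2"
  assumes "invertible A"
  shows "(A $ 2 $ 1 = 0 \<longrightarrow> closure (Num_AD A) = closure (rays (closure (Num_matrix A)))) \<and>
         (A $ 2 $ 1 \<noteq> 0 \<longrightarrow> Num_AD A = UNIV)"
  using Num_AD_subset_rays[of A] rays_subset_Num_AD[of A] Num_AD_eq_UNIV[of A]
  by (auto simp: closure_rays_closure)

end
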